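(* Let $\mathcal A_\tau$ be the 2-graph algebra for the permutation $\tau\in S_n$ and let $\alpha\in E$, where $E\times\{0\}$ is the open core of the Gelfand space $\Omega_\tau$, i.e. $E=\{z\in\mathbb B_n:\tau(z)=z\}$. (i) There is a biholomorphic automorphism $\theta:\mathbb B_n\to\mathbb B_n$ with $\theta(E)=E$, $\theta(0)=\alpha$ and $\theta=\tau^{-1}\theta\tau$, where $\tau$ also denotes the coordinate shift automorphism of $\mathbb B_n$. (ii) There is an isometric operator algebra automorphism $\Theta:\mathcal A_n\to\mathcal A_n$ which extends the ball automorphism $\theta$ in (i) and which satisfies $\Theta=T^{-1}\Theta T$, where $T:\mathcal A_n\to\mathcal A_n$ is the coordinate shift automorphism such that $T(L_{e_i})=L_{e_{\tau(i)}}$.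
   Context: $\mathbb B_n$ is the open Euclidean unit ball of $\mathbb C^n$. For $\tau\in S_n$, $\tau(z)=(z_{\tau(1)},\dots,z_{\tau(n)})$ is the coordinate shift on $\mathbb C^n$. $\mathcal A_n$ is the noncommutative disc algebra: the norm closed algebra generated by the identity and the left creation isometries $L_{e_1},\dots,L_{e_n}$ on $\ell^2(\mathbb F_n^+)$, where $\mathbb F_n^+$ is the free unital semigroup on $e_1,\dots,e_n$ and $L_{e_i}\xi_w=\xi_{e_iw}$. Its character space is identified with $\overline{\mathbb B}_n$ via $\lambda\leftrightarrow\varphi_\lambda$, $\varphi_\lambda(L_{e_i})=\lambda_i$. That $\Theta$ extends the ball automorphism $\theta$ means that the homeomorphism of the character space induced by $\Theta$, $\varphi\mapsto\varphi\circ\Theta^{-1}$, restricts to $\theta$ on $\mathbb B_n$. $\mathcal A_\tau$ is the norm closed operator algebra generated by the left regular representation ($L_v\xi_w=\xi_{vw}$) of the unital semigroup with generators $e_1,\dots,e_n,f$ and relations $e_if=fe_{\tau(i)}$, on the Hilbert space with orthonormal basis indexed by this semigroup. Its Gelfand space is $\Omega_\tau=(\overline{\mathbb B}_n\times\{0\})\cup((U\cap\overline{\mathbb B}_n)\times\overline{\mathbb B}_1)\subseteq\mathbb C^n\times\mathbb C$ with $U=\{z\in\mathbb C^n:\tau(z)=z\}$, and its open core is $(U\cap\mathbb B_n)\times\{0\}$. *)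

theory Defs
  imports "HOL-Analysis.Analysis"
begin

section \<open>Holomorphic maps and coordinate shifts on \<open>\<complex>\<^sup>n\<close>\<close>

text \<open>
  \<open>\<complex>\<^sup>n\<close> is \<^typ>\<open>complex ^ 'n\<close> with \<open>n = CARD('n)\<close>; its library norm is the Euclidean norm, so
  the open unit ball is \<open>ball 0 1\<close>. The library has no holomorphic maps of several
  variables: \<open>f\<close> is holomorphic on an open set if at each point it has a Frechet derivative
  that is complex linear.
\<close>

definition holomorphic_vec_on :: "(complex ^ 'm::finite \<Rightarrow> complex ^ 'n::finite) \<Rightarrow> (complex ^ 'm) set \<Rightarrow> bool"
  where "holomorphic_vec_on f S \<longleftrightarrow>
    (\<forall>z\<in>S. \<exists>D. (f has_derivative D) (at z) \<and> (\<forall>c v. D (c *s v) = c *s D v))"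

definition ball_automorphism :: "(complex ^ 'n::finite \<Rightarrow> complex ^ 'n) \<Rightarrow> bool"
  where "ball_automorphism \<theta> \<longleftrightarrow>
    bij_betw \<theta> (ball 0 1) (ball 0 1) \<and>
    holomorphic_vec_on \<theta> (ball 0 1) \<and>
    holomorphic_vec_on (inv_into (ball 0 1) \<theta>) (ball 0 1)"

definition coord_shift :: "('n::finite \<Rightarrow> 'n) \<Rightarrow> complex ^ 'n \<Rightarrow> complex ^ 'n"
  where "coord_shift \<tau> z = (\<chi> i. z $ \<tau> i)"

text \<open>
  The Gelfand space of the 2-graph algebra \<open>\<A>\<^sub>\<tau>\<close> of the relations
  \<open>e\<^sub>i f = f e\<^bsub>\<tau>(i)\<^esub>\<close> is
  \<open>(cball 0 1 \<times> {0}) \<union> ((U \<inter> cball 0 1) \<times> cball 0 1)\<close> with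
  \<open>U = {z. coord_shift \<tau> z = z}\<close>, and its open core is \<open>core_base \<tau> \<times> {0}\<close>.
\<close>

definition core_base :: "('n::finite \<Rightarrow> 'n) \<Rightarrow> (complex ^ 'n) set"
  where "core_base \<tau> = {z \<in> ball 0 1. coord_shift \<tau> z = z}"


section \<open>The Hilbert space \<open>\<ell>\<^sup>2(X)\<close> and its bounded operators\<close>

typedef 'a ell2 = "{f :: 'a \<Rightarrow> complex. (\<lambda>x. (cmod (f x))\<^sup>2) summable_on UNIV}"
  morphisms ell2_coeff Abs_ell2
  by (rule exI[of _ "\<lambda>_. 0"]) simp

setup_lifting type_definition_ell2

lemma ell2_inner_summable:
  fixes f g :: "'a \<Rightarrow> complex"
  assumes f: "(\<lambda>x. (cmod (f x))\<^sup>2) summable_on UNIV"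
    and g: "(\<lambda>x. (cmod (g x))\<^sup>2) summable_on UNIV"
  shows "(\<lambda>x. f x \<bullet> g x) summable_on UNIV"
proof -
  have s: "(\<lambda>x. (cmod (f x))\<^sup>2 + (cmod (g x))\<^sup>2) summable_on UNIV"
    by (rule summable_on_add[OF f g])
  have bound: "norm (f x \<bullet> g x) \<le> (cmod (f x))\<^sup>2 + (cmod (g x))\<^sup>2" for x
  proof -
    have "norm (f x \<bullet> g x) \<le> cmod (f x) * cmod (g x)"
      by (simp add: Cauchy_Schwarz_ineq2)
    also have "\<dots> \<le> (cmod (f x))\<^sup>2 + (cmod (g x))\<^sup>2"
      using sum_squares_bound[of "cmod (f x)" "cmod (g x)"]
        mult_nonneg_nonneg[OF norm_ge_zero norm_ge_zero, of "f x" "g x"]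
      by linarith
    finally show ?thesis .
  qed
  have "(\<lambda>x. norm (f x \<bullet> g x)) summable_on UNIV"
    using s bound by (intro summable_on_comparison_test[OF s]) auto
  then show ?thesis
    by (rule abs_summable_summable)
qed

lemma ell2_coeff_summable: "(\<lambda>x. (cmod (ell2_coeff f x))\<^sup>2) summable_on UNIV"
  using ell2_coeff[of f] by simp

lemma ell2_add_summable:
  fixes f g :: "'a \<Rightarrow> complex"
  assumes f: "(\<lambda>x. (cmod (f x))\<^sup>2) summable_on UNIV"
    and g: "(\<lambda>x. (cmod (g x))\<^sup>2) summable_on UNIV"
  shows "(\<lambda>x. (cmod (f x + g x))\<^sup>2) summable_on UNIV"
proof -
  have "(cmod (f x + g x))\<^sup>2 = (cmod (f x))\<^sup>2 + (cmod (g x))\<^sup>2 + 2 * (f x \<bullet> g x)" for x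
    by (simp add: power2_norm_eq_inner inner_add_left inner_add_right inner_commute)
  then show ?thesis
    by (simp only:) (intro summable_on_add f g summable_on_cmult_right ell2_inner_summable)
qed

lemma ell2_mult_summable:
  fixes f :: "'a \<Rightarrow> complex"
  assumes f: "(\<lambda>x. (cmod (f x))\<^sup>2) summable_on UNIV"
  shows "(\<lambda>x. (cmod (c * f x))\<^sup>2) summable_on UNIV"
  unfolding norm_mult power_mult_distrib by (intro summable_on_cmult_right f)

text \<open>
  As a real inner product space \<open>\<ell>\<^sup>2(X)\<close> carries the real part of its usual inner product, which
  yields the usual norm.
\<close>

instantiation ell2 :: (type) real_inner
begin

lift_definition zero_ell2 :: "'a ell2" is "\<lambda>_. 0"
  by simp

lift_definition plus_ell2 :: "'a ell2 \<Rightarrow> 'a ell2 \<Rightarrow> 'a ell2" is "\<lambda>f g x. f x + g x"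
  by (rule ell2_add_summable)

lift_definition uminus_ell2 :: "'a ell2 \<Rightarrow> 'a ell2" is "\<lambda>f x. - f x"
  by simp

definition minus_ell2 :: "'a ell2 \<Rightarrow> 'a ell2 \<Rightarrow> 'a ell2"
  where "minus_ell2 f g = f + - g"

lift_definition scaleR_ell2 :: "real \<Rightarrow> 'a ell2 \<Rightarrow> 'a ell2" is "\<lambda>r f x. complex_of_real r * f x"
  by (rule ell2_mult_summable)

definition inner_ell2 :: "'a ell2 \<Rightarrow> 'a ell2 \<Rightarrow> real"
  where "inner_ell2 f g = (\<Sum>\<^sub>\<infinity>x. ell2_coeff f x \<bullet> ell2_coeff g x)"

definition norm_ell2 :: "'a ell2 \<Rightarrow> real"
  where "norm_ell2 f = sqrt (\<Sum>\<^sub>\<infinity>x. (cmod (ell2_coeff f x))\<^sup>2)"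

definition sgn_ell2 :: "'a ell2 \<Rightarrow> 'a ell2"
  where "sgn_ell2 f = inverse (norm f) *\<^sub>R f"

definition dist_ell2 :: "'a ell2 \<Rightarrow> 'a ell2 \<Rightarrow> real"
  where "dist_ell2 f g = norm (f - g)"

definition uniformity_ell2 :: "('a ell2 \<times> 'a ell2) filter"
  where "uniformity_ell2 = (INF e\<in>{0<..}. principal {(f, g). dist f g < e})"

definition open_ell2 :: "'a ell2 set \<Rightarrow> bool"
  where "open_ell2 U \<longleftrightarrow> (\<forall>f\<in>U. eventually (\<lambda>(f', g). f' = f \<longrightarrow> g \<in> U) uniformity)"

instance
proof
  fix f g h :: "'a ell2" and r s :: real
  have sm: "(\<lambda>x. ell2_coeff f x \<bullet> ell2_coeff g x) summable_on UNIV" for f g :: "'a ell2"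
    by (intro ell2_inner_summable ell2_coeff_summable)
  show "f + g + h = f + (g + h)" by transfer (simp add: add.assoc)
  show "f + g = g + f" by transfer (simp add: add.commute)
  show "0 + f = f" by transfer simp
  show "- f + f = 0" by transfer simp
  show "f - g = f + - g" by (simp add: minus_ell2_def)
  show "r *\<^sub>R (f + g) = r *\<^sub>R f + r *\<^sub>R g" by transfer (simp add: algebra_simps)
  show "(r + s) *\<^sub>R f = r *\<^sub>R f + s *\<^sub>R f" by transfer (simp add: algebra_simps)
  show "r *\<^sub>R s *\<^sub>R f = (r * s) *\<^sub>R f" by transfer (simp add: algebra_simps)
  show "1 *\<^sub>R f = f" by transfer simp
  show "dist f g = norm (f - g)" by (simp add: dist_ell2_def)
  show "sgn f = inverse (norm f) *\<^sub>R f" by (simp add: sgn_ell2_def)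
  show "uniformity = (INF e\<in>{0<..}. principal {(f, g :: 'a ell2). dist f g < e})"
    by (simp add: uniformity_ell2_def)
  show "open U \<longleftrightarrow> (\<forall>f\<in>U. eventually (\<lambda>(f', g). f' = f \<longrightarrow> g \<in> U) uniformity)"
    for U :: "'a ell2 set"
    by (simp add: open_ell2_def)
  show "f \<bullet> g = g \<bullet> f" by (simp add: inner_ell2_def inner_commute)
  show "(f + g) \<bullet> h = f \<bullet> h + g \<bullet> h"
    unfolding inner_ell2_def plus_ell2.rep_eq inner_add_left
    by (rule infsum_add[OF sm sm])
  have "ell2_coeff (r *\<^sub>R f) x = r *\<^sub>R ell2_coeff f x" for x
    by (simp add: scaleR_ell2.rep_eq scaleR_conv_of_real)
  then show "(r *\<^sub>R f) \<bullet> g = r * (f \<bullet> g)"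
    unfolding inner_ell2_def by (simp add: infsum_cmult_right')
  show "0 \<le> f \<bullet> f" unfolding inner_ell2_def by (intro infsum_nonneg) simp
  show "f \<bullet> f = 0 \<longleftrightarrow> f = 0"
  proof
    assume "f \<bullet> f = 0"
    then have "ell2_coeff f x \<bullet> ell2_coeff f x = 0" for x
      unfolding inner_ell2_def
      by (intro nonneg_infsum_le_0D[OF _ sm]) auto
    then have "ell2_coeff f x = 0" for x by simp
    then show "f = 0" by transfer auto
  next
    assume "f = 0"
    then show "f \<bullet> f = 0" by (simp add: inner_ell2_def zero_ell2.rep_eq)
  qed
  show "norm f = sqrt (f \<bullet> f)"
    by (simp add: norm_ell2_def inner_ell2_def power2_norm_eq_inner)
qed

end

lift_definition scaleC_ell2 :: "complex \<Rightarrow> 'a ell2 \<Rightarrow> 'a ell2" is "\<lambda>c f x. c * f x"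
  by (rule ell2_mult_summable)

lemma norm_scaleC_ell2: "norm (scaleC_ell2 c f) = cmod c * norm f"
  by (simp add: norm_ell2_def scaleC_ell2.rep_eq norm_mult power_mult_distrib
      infsum_cmult_right' real_sqrt_mult)

lift_definition scalar_op :: "complex \<Rightarrow> 'a ell2 \<Rightarrow>\<^sub>L 'a ell2" is scaleC_ell2
proof (rule bounded_linear_intro)
  fix c :: complex and f g :: "'a ell2" and r :: real
  show "scaleC_ell2 c (f + g) = scaleC_ell2 c f + scaleC_ell2 c g"
    by transfer (simp add: algebra_simps)
  show "scaleC_ell2 c (r *\<^sub>R f) = r *\<^sub>R scaleC_ell2 c f"
    by transfer (simp add: algebra_simps)
  show "norm (scaleC_ell2 c f) \<le> norm f * cmod c"
    by (simp add: norm_scaleC_ell2 mult.commute)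
qed

text \<open>
  Bounded operators are elements of \<^typ>\<open>'a ell2 \<Rightarrow>\<^sub>L 'a ell2\<close>, with the operator norm. This type
  consists of the real linear bounded maps; the algebras below are generated by complex linear
  ones and hence contain only complex linear ones.
\<close>

abbreviation scale_op :: "complex \<Rightarrow> ('a ell2 \<Rightarrow>\<^sub>L 'a ell2) \<Rightarrow> ('a ell2 \<Rightarrow>\<^sub>L 'a ell2)" (infixr "*\<^sub>o" 75)
  where "c *\<^sub>o a \<equiv> scalar_op c o\<^sub>L a"

definition unital_op_algebra :: "('a ell2 \<Rightarrow>\<^sub>L 'a ell2) set \<Rightarrow> bool"
  where "unital_op_algebra A \<longleftrightarrow>
    id_blinfun \<in> A \<and>
    (\<forall>a\<in>A. \<forall>b\<in>A. a + b \<in> A \<and> a o\<^sub>L b \<in> A) \<and>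
    (\<forall>c. \<forall>a\<in>A. c *\<^sub>o a \<in> A)"

definition closed_algebra_generated :: "('a ell2 \<Rightarrow>\<^sub>L 'a ell2) set \<Rightarrow> ('a ell2 \<Rightarrow>\<^sub>L 'a ell2) set"
  where "closed_algebra_generated S = \<Inter>{A. unital_op_algebra A \<and> closed A \<and> S \<subseteq> A}"

definition isometric_automorphism ::
    "('a ell2 \<Rightarrow>\<^sub>L 'a ell2) set \<Rightarrow> (('a ell2 \<Rightarrow>\<^sub>L 'a ell2) \<Rightarrow> ('a ell2 \<Rightarrow>\<^sub>L 'a ell2)) \<Rightarrow> bool"
  where "isometric_automorphism A \<Theta> \<longleftrightarrow>
    bij_betw \<Theta> A A \<and>
    (\<forall>a\<in>A. \<forall>b\<in>A. \<Theta> (a + b) = \<Theta> a + \<Theta> b \<and> \<Theta> (a o\<^sub>L b) = \<Theta> a o\<^sub>L \<Theta> b) \<and>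
    (\<forall>c. \<forall>a\<in>A. \<Theta> (c *\<^sub>o a) = c *\<^sub>o \<Theta> a) \<and>
    (\<forall>a\<in>A. norm (\<Theta> a) = norm a)"

text \<open>
  A character is normalised to be \<open>undefined\<close> outside the algebra, so that it is determined by its
  restriction to the algebra.
\<close>

definition characters :: "('a ell2 \<Rightarrow>\<^sub>L 'a ell2) set \<Rightarrow> (('a ell2 \<Rightarrow>\<^sub>L 'a ell2) \<Rightarrow> complex) set"
  where "characters A = {\<phi> \<in> extensional A.
    \<phi> id_blinfun = 1 \<and>
    (\<forall>a\<in>A. \<forall>b\<in>A. \<phi> (a + b) = \<phi> a + \<phi> b \<and> \<phi> (a o\<^sub>L b) = \<phi> a * \<phi> b) \<and>
    (\<forall>c. \<forall>a\<in>A. \<phi> (c *\<^sub>o a) = c * \<phi> a)}"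


section \<open>The noncommutative disc algebra\<close>

text \<open>
  The free unital semigroup on \<open>e\<^sub>i\<close>, \<open>i :: 'n\<close>, is \<^typ>\<open>'n list\<close> under concatenation.
\<close>

definition creation_coeff :: "'n \<Rightarrow> ('n list \<Rightarrow> complex) \<Rightarrow> 'n list \<Rightarrow> complex"
  where "creation_coeff i f w = (case w of [] \<Rightarrow> 0 | j # u \<Rightarrow> if j = i then f u else 0)"

lemma creation_coeff_has_sum:
  fixes f :: "'n list \<Rightarrow> complex"
  assumes "((\<lambda>w. (cmod (f w))\<^sup>2) has_sum s) UNIV"
  shows "((\<lambda>w. (cmod (creation_coeff i f w))\<^sup>2) has_sum s) UNIV"
proof -
  have "((\<lambda>w. (cmod (creation_coeff i f w))\<^sup>2) has_sum s) (range (Cons i))"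
    using assms by (subst has_sum_reindex) (auto simp: o_def creation_coeff_def)
  moreover have "creation_coeff i f w = 0" if "w \<notin> range (Cons i)" for w
    using that by (auto simp: creation_coeff_def split: list.splits)
  ultimately show ?thesis
    by (subst has_sum_cong_neutral[where T = "range (Cons i)"]) auto
qed

lift_definition creation_fun :: "'n \<Rightarrow> 'n list ell2 \<Rightarrow> 'n list ell2" is creation_coeff
  using creation_coeff_has_sum by (metis summable_on_def)

lemma norm_creation_fun: "norm (creation_fun i f) = norm f"
  unfolding norm_ell2_def creation_fun.rep_eq
  using creation_coeff_has_sum[OF has_sum_infsum[OF ell2_coeff_summable[of f]]]
  by (metis infsumI)

lift_definition creation :: "'n \<Rightarrow> 'n list ell2 \<Rightarrow>\<^sub>L 'n list ell2" is creation_fun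
proof (rule bounded_linear_intro)
  fix i :: 'n and f g :: "'n list ell2" and r :: real
  show "creation_fun i (f + g) = creation_fun i f + creation_fun i g"
    by transfer (auto simp: creation_coeff_def fun_eq_iff split: list.splits)
  show "creation_fun i (r *\<^sub>R f) = r *\<^sub>R creation_fun i f"
    by transfer (auto simp: creation_coeff_def fun_eq_iff split: list.splits)
  show "norm (creation_fun i f) \<le> norm f * 1"
    by (simp add: norm_creation_fun)
qed

lift_definition basis_ell2 :: "'a \<Rightarrow> 'a ell2" is "\<lambda>x y. if y = x then 1 else 0"
  by (rule finite_nonzero_values_imp_summable_on) auto

lemma creation_basis: "blinfun_apply (creation i) (basis_ell2 w) = basis_ell2 (i # w)"
  by (auto simp: ell2_coeff_inject[symmetric] creation.rep_eq creation_fun.rep_eq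
      basis_ell2.rep_eq creation_coeff_def fun_eq_iff split: list.splits)

definition nc_disc_algebra :: "('n::finite list ell2 \<Rightarrow>\<^sub>L 'n list ell2) set"
  where "nc_disc_algebra = closed_algebra_generated (range creation)"

text \<open>
  The character \<open>\<phi>\<^sub>\<mu>\<close> of the noncommutative disc algebra. It exists exactly for \<open>\<mu>\<close> in
  the closed unit ball, and is unique because characters are automatically contractive.
\<close>

definition point_character :: "complex ^ 'n::finite \<Rightarrow> ('n list ell2 \<Rightarrow>\<^sub>L 'n list ell2) \<Rightarrow> complex"
  where "point_character \<mu> =
    (THE \<phi>. \<phi> \<in> characters nc_disc_algebra \<and> (\<forall>i. \<phi> (creation i) = \<mu> $ i))"

text \<open>
  \<open>\<phi> \<mapsto> \<phi> \<circ> \<Theta>\<^sup>-\<^sup>1\<close> restricts to \<open>\<theta>\<close> on the open ball, under \<open>\<mu> \<leftrightarrow> \<phi>\<^sub>\<mu>\<close>.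
\<close>

definition extends_ball_map ::
    "(('n::finite list ell2 \<Rightarrow>\<^sub>L 'n list ell2) \<Rightarrow> ('n list ell2 \<Rightarrow>\<^sub>L 'n list ell2)) \<Rightarrow>
     (complex ^ 'n \<Rightarrow> complex ^ 'n) \<Rightarrow> bool"
  where "extends_ball_map \<Theta> \<theta> \<longleftrightarrow>
    (\<forall>\<mu>\<in>ball 0 1. \<forall>a\<in>nc_disc_algebra.
      point_character \<mu> (inv_into nc_disc_algebra \<Theta> a) = point_character (\<theta> \<mu>) a)"

text \<open>
  Existence: for a permutation \<open>\<tau>\<close>, conjugation with the unitary permuting the letters of
  words has these properties. Uniqueness: two such maps agree on a dense subalgebra.
\<close>

definition shift_automorphism ::
    "('n::finite \<Rightarrow> 'n) \<Rightarrow> ('n list ell2 \<Rightarrow>\<^sub>L 'n list ell2) \<Rightarrow> ('n list ell2 \<Rightarrow>\<^sub>L 'n list ell2)"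
  where "shift_automorphism \<tau> =
    (THE T. T \<in> extensional nc_disc_algebra \<and> isometric_automorphism nc_disc_algebra T \<and>
      (\<forall>i. T (creation i) = creation (\<tau> i)))"

end

theory Submission
  imports Defs
begin

text \<open>
  For \<open>\<theta>\<close> one takes the Moebius involution of the ball that exchanges \<open>0\<close> and \<open>\<alpha>\<close>. Its formula only
  involves \<open>\<alpha>\<close> and inner products, so it commutes with unitary maps fixing \<open>\<alpha>\<close>, in particular with the
  coordinate shift (\<open>moebius_coord_shift\<close>); this also gives \<open>\<theta>(E) = E\<close>.

  The automorphism \<open>\<Theta>\<close> is Voiculescu's. Let \<open>L\<^sub>i\<close> be the creation operators, \<open>s\<^sup>2 = 1 - \<parallel>\<alpha>\<parallel>\<^sup>2\<close>,
  \<open>A = \<Sum>\<^sub>j cnj (\<alpha>\<^sub>j) L\<^sub>j\<close>, and let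
  \<open>V\<^sub>i = (1 - A)\<inverse> N\<^sub>i\<close> with \<open>N\<^sub>i = \<alpha>\<^sub>i (1 - A / (1 + s)) - s L\<^sub>i\<close>, which is \<open>\<theta>\<^sub>i\<close> with operators as arguments. Three
  facts about this row carry the proof. It is a row isometry, \<open>V\<^sub>i\<^sup>* V\<^sub>j = \<delta>\<^sub>i\<^sub>j\<close> (\<open>row_isometry_moebius\<close>). The unit
  vector \<open>\<eta> = s (1 - A)\<inverse> \<xi>\<close>, with \<open>\<xi>\<close> the vacuum vector, is orthogonal to the ranges of all \<open>V\<^sub>i\<close>
  (\<open>moebius_wandering\<close>). And substituting the \<open>V\<^sub>j\<close> for the \<open>L\<^sub>j\<close> in the formula for \<open>V\<^sub>i\<close> returns \<open>L\<^sub>i\<close>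
  (\<open>moebius_row_inverse\<close>).

  The first two facts make the products \<open>V\<^sub>w \<eta>\<close> over words \<open>w\<close> orthonormal, so \<open>\<xi>\<^sub>w \<mapsto> V\<^sub>w \<eta>\<close> is an isometry \<open>W\<close>
  with \<open>V\<^sub>i W = W L\<^sub>i\<close>. Solving \<open>a W = W c\<close> for \<open>c\<close> gives a contractive homomorphism from the algebra
  generated by the \<open>V\<^sub>i\<close> to the disc algebra with \<open>V\<^sub>i \<mapsto> L\<^sub>i\<close> (\<open>contractive_hom_of_wandering_vector\<close>). By the
  third fact the \<open>V\<^sub>i\<close> generate the whole disc algebra and \<open>L\<^sub>i \<mapsto> V\<^sub>i\<close>. So the homomorphism is an
  involution, and a contractive involution is isometric; no surjectivity of \<open>W\<close> has to be shown.

  The same construction with a permuted row of creation operators yields the shift automorphism \<open>T\<close>. That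
  \<open>\<Theta>\<close> commutes with \<open>T\<close> and induces \<open>\<theta>\<close> on characters is read off from
  \<open>(1 - A) \<Theta>(L\<^sub>i) = N\<^sub>i\<close>, because contractive homomorphisms and characters are determined by the
  generators; for characters this rests on automatic contractivity (\<open>norm_character_le\<close>).
\<close>


section \<open>The Hilbert space \<open>\<ell>\<^sup>2(X)\<close>\<close>

lemma ell2_eqI: "(\<And>w. ell2_coeff f w = ell2_coeff g w) \<Longrightarrow> f = g"
  by (simp add: ell2_coeff_inject[symmetric] fun_eq_iff)

lemma ell2_coeff_diff: "ell2_coeff (f - g) w = ell2_coeff f w - ell2_coeff g w"
  unfolding minus_ell2_def plus_ell2.rep_eq uminus_ell2.rep_eq by simp

lemma ell2_coeff_sum: "ell2_coeff (sum f F) w = (\<Sum>i\<in>F. ell2_coeff (f i) w)"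
  by (induction F rule: infinite_finite_induct) (auto simp: zero_ell2.rep_eq plus_ell2.rep_eq)

lemmas ell2_coeff_simps = zero_ell2.rep_eq plus_ell2.rep_eq uminus_ell2.rep_eq ell2_coeff_diff
  scaleR_ell2.rep_eq scaleC_ell2.rep_eq ell2_coeff_sum basis_ell2.rep_eq

lemma norm_ell2_sq: "(norm f)\<^sup>2 = (\<Sum>\<^sub>\<infinity>x. (cmod (ell2_coeff f x))\<^sup>2)"
  unfolding norm_ell2_def by (simp add: infsum_nonneg)

lemma finite_sum_le_norm_ell2:
  "finite F \<Longrightarrow> (\<Sum>x\<in>F. (cmod (ell2_coeff f x))\<^sup>2) \<le> (norm f)\<^sup>2"
  unfolding norm_ell2_sq by (rule finite_sum_le_infsum[OF ell2_coeff_summable]) auto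

lemma ell2_coeff_le_norm: "cmod (ell2_coeff f w) \<le> norm f"
  using finite_sum_le_norm_ell2[of "{w}" f] by (auto intro: power2_le_imp_le[OF _ norm_ge_zero])

text \<open>
  Completeness makes the two kinds of series below converge: orthogonal series of vectors, and
  Neumann series of operators.
\<close>

instance ell2 :: (type) banach
proof
  fix X :: "nat \<Rightarrow> 'a ell2"
  assume X: "Cauchy X"
  have "Cauchy (\<lambda>n. ell2_coeff (X n) w)" for w
  proof (rule metric_CauchyI)
    fix e :: real assume "e > 0"
    then obtain N where N: "\<And>m n. m \<ge> N \<Longrightarrow> n \<ge> N \<Longrightarrow> dist (X m) (X n) < e"
      using metric_CauchyD[OF X] by blast
    have "dist (ell2_coeff (X m) w) (ell2_coeff (X n) w) < e" if "m \<ge> N" "n \<ge> N" for m n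
      using N[OF that] ell2_coeff_le_norm[of "X m - X n" w]
      by (simp add: dist_norm ell2_coeff_diff)
    then show "\<exists>N. \<forall>m\<ge>N. \<forall>n\<ge>N. dist (ell2_coeff (X m) w) (ell2_coeff (X n) w) < e"
      by blast
  qed
  then have "\<forall>w. \<exists>l. (\<lambda>n. ell2_coeff (X n) w) \<longlonglongrightarrow> l"
    using Cauchy_convergent convergent_def by blast
  then obtain g where g: "\<And>w. (\<lambda>n. ell2_coeff (X n) w) \<longlonglongrightarrow> g w"
    by metis
  have key: "\<exists>N. \<forall>m\<ge>N. \<forall>F. finite F \<longrightarrow> (\<Sum>w\<in>F. (cmod (ell2_coeff (X m) w - g w))\<^sup>2) \<le> e\<^sup>2"
    if "e > 0" for e :: real
  proof -
    obtain N where N: "\<And>m n. m \<ge> N \<Longrightarrow> n \<ge> N \<Longrightarrow> dist (X m) (X n) < e"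
      using metric_CauchyD[OF X \<open>e > 0\<close>] by blast
    have "(\<Sum>w\<in>F. (cmod (ell2_coeff (X m) w - g w))\<^sup>2) \<le> e\<^sup>2" if "m \<ge> N" "finite F" for m F
    proof (rule tendsto_upperbound)
      show "(\<lambda>n. \<Sum>w\<in>F. (cmod (ell2_coeff (X m) w - ell2_coeff (X n) w))\<^sup>2)
          \<longlonglongrightarrow> (\<Sum>w\<in>F. (cmod (ell2_coeff (X m) w - g w))\<^sup>2)"
        by (intro tendsto_intros g)
      show "\<forall>\<^sub>F n in sequentially. (\<Sum>w\<in>F. (cmod (ell2_coeff (X m) w - ell2_coeff (X n) w))\<^sup>2) \<le> e\<^sup>2"
      proof (rule eventually_sequentiallyI[of N])
        fix n assume "n \<ge> N"
        then have "(norm (X m - X n))\<^sup>2 \<le> e\<^sup>2"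
          using N[OF \<open>m \<ge> N\<close>] by (intro power_mono) (auto simp: dist_norm less_imp_le)
        with finite_sum_le_norm_ell2[OF \<open>finite F\<close>, of "X m - X n"]
        show "(\<Sum>w\<in>F. (cmod (ell2_coeff (X m) w - ell2_coeff (X n) w))\<^sup>2) \<le> e\<^sup>2"
          by (simp add: ell2_coeff_diff)
      qed
    qed simp
    then show ?thesis by blast
  qed
  have diff: "(\<lambda>w. (cmod (ell2_coeff (X m) w - g w))\<^sup>2) summable_on UNIV"
    if "\<And>F. finite F \<Longrightarrow> (\<Sum>w\<in>F. (cmod (ell2_coeff (X m) w - g w))\<^sup>2) \<le> e\<^sup>2" for m and e :: real
    using that by (intro nonneg_bdd_above_summable_on bdd_aboveI2[where M = "e\<^sup>2"]) auto
  obtain m where "\<And>F. finite F \<Longrightarrow> (\<Sum>w\<in>F. (cmod (ell2_coeff (X m) w - g w))\<^sup>2) \<le> 1\<^sup>2"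
    using key[of 1] by auto
  from diff[OF this] have "(\<lambda>w. (cmod (- 1 * (ell2_coeff (X m) w - g w)))\<^sup>2) summable_on UNIV"
    by (simp only: norm_mult norm_minus_cancel norm_one mult_1)
  from ell2_add_summable[OF ell2_coeff_summable[of "X m"] this]
  have "(\<lambda>w. (cmod (g w))\<^sup>2) summable_on UNIV" by simp
  then have G: "ell2_coeff (Abs_ell2 g) = g"
    by (simp add: Abs_ell2_inverse)
  have "X \<longlonglongrightarrow> Abs_ell2 g"
  proof (rule metric_LIMSEQ_I)
    fix r :: real assume "r > 0"
    then obtain N where N: "\<And>m F. m \<ge> N \<Longrightarrow> finite F \<Longrightarrow>
        (\<Sum>w\<in>F. (cmod (ell2_coeff (X m) w - g w))\<^sup>2) \<le> (r / 2)\<^sup>2"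
      using key[of "r / 2"] by auto
    have "dist (X m) (Abs_ell2 g) < r" if "m \<ge> N" for m
    proof -
      have "(norm (X m - Abs_ell2 g))\<^sup>2 \<le> (r / 2)\<^sup>2"
        unfolding norm_ell2_sq ell2_coeff_diff G
        by (rule infsum_le_finite_sums[OF diff]) (rule N[OF that], assumption)+
      then have "norm (X m - Abs_ell2 g) \<le> r / 2"
        using \<open>r > 0\<close> by (auto intro: power2_le_imp_le[OF _ less_imp_le])
      then show ?thesis using \<open>r > 0\<close> by (simp add: dist_norm)
    qed
    then show "\<exists>N. \<forall>m\<ge>N. dist (X m) (Abs_ell2 g) < r" by blast
  qed
  then show "convergent X" by (auto simp: convergent_def)
qed

lemma scaleC_add_right: "scaleC_ell2 c (x + y) = scaleC_ell2 c x + scaleC_ell2 c y"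
  and scaleC_diff_right: "scaleC_ell2 c (x - y) = scaleC_ell2 c x - scaleC_ell2 c y"
  and scaleC_scaleC [simp]: "scaleC_ell2 c (scaleC_ell2 d x) = scaleC_ell2 (c * d) x"
  and scaleC_one [simp]: "scaleC_ell2 1 x = x"
  and scaleC_of_real: "scaleC_ell2 (complex_of_real r) x = r *\<^sub>R x"
  and scaleC_sum_right: "scaleC_ell2 c (sum g F) = (\<Sum>i\<in>F. scaleC_ell2 c (g i))"
  by (rule ell2_eqI; simp add: ell2_coeff_simps algebra_simps sum_distrib_left)+

lemma inner_scaleC_left: "scaleC_ell2 c x \<bullet> y = x \<bullet> scaleC_ell2 (cnj c) y"
  unfolding inner_ell2_def by (rule infsum_cong) (simp add: ell2_coeff_simps inner_complex_def algebra_simps)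

lemma inner_scaleC_self: "scaleC_ell2 c x \<bullet> scaleC_ell2 d x = (c \<bullet> d) * (norm x)\<^sup>2"
proof -
  have "ell2_coeff (scaleC_ell2 c x) a \<bullet> ell2_coeff (scaleC_ell2 d x) a =
      (c \<bullet> d) * (cmod (ell2_coeff x a))\<^sup>2" for a
    by (simp add: ell2_coeff_simps inner_complex_def cmod_power2) algebra
  then show ?thesis
    by (simp add: inner_ell2_def norm_ell2_sq infsum_cmult_right')
qed

lemma apply_scalar_op [simp]: "blinfun_apply (scalar_op c) x = scaleC_ell2 c x"
  by (simp add: scalar_op.rep_eq)

lemma norm_basis_ell2 [simp]: "norm (basis_ell2 x) = 1"
proof -
  have "(norm (basis_ell2 x))\<^sup>2 = (\<Sum>\<^sub>\<infinity>y\<in>{x}. 1)"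
    unfolding norm_ell2_sq by (rule infsum_cong_neutral) (auto simp: basis_ell2.rep_eq)
  then show ?thesis
    by (simp add: power2_eq_1_iff) (smt (verit) norm_ge_zero)
qed

text \<open>
  The partial sums of \<open>\<Sum>\<^sub>a h(a) u(a)\<close> have the norms of the partial sums of \<open>h\<close>, so they converge and their
  limit depends isometrically on \<open>h\<close>. Orthonormality for the complex inner product is expressed through
  the real one by letting both vectors carry scalars.
\<close>

lemma orthonormal_isometry:
  fixes u :: "'a \<Rightarrow> 'b ell2"
  assumes orth: "\<And>a b c d. scaleC_ell2 c (u a) \<bullet> scaleC_ell2 d (u b) = (if a = b then c \<bullet> d else 0)"
  obtains W :: "'a ell2 \<Rightarrow>\<^sub>L 'b ell2"
  where "\<And>h. norm (blinfun_apply W h) = norm h"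
    and "\<And>h. ((\<lambda>a. scaleC_ell2 (ell2_coeff h a) (u a)) has_sum blinfun_apply W h) UNIV"
proof -
  define S where "S h F = (\<Sum>a\<in>F. scaleC_ell2 (ell2_coeff h a) (u a))" for h F
  have norm_S: "(norm (S h F))\<^sup>2 = (\<Sum>a\<in>F. (cmod (ell2_coeff h a))\<^sup>2)" if "finite F" for h F
  proof -
    have "(norm (S h F))\<^sup>2 = S h F \<bullet> S h F" by (rule power2_norm_eq_inner)
    also have "\<dots> = (\<Sum>a\<in>F. \<Sum>b\<in>F. if a = b then ell2_coeff h a \<bullet> ell2_coeff h b else 0)"
      unfolding S_def inner_sum_left inner_sum_right orth by (rule sum.swap)
    also have "\<dots> = (\<Sum>a\<in>F. (cmod (ell2_coeff h a))\<^sup>2)"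
      using that by (intro sum.cong refl) (simp add: sum.delta' power2_norm_eq_inner)
    finally show ?thesis .
  qed
  have summable: "(\<lambda>a. scaleC_ell2 (ell2_coeff h a) (u a)) summable_on UNIV" for h
  proof -
    have ev: "\<exists>P. eventually P (finite_subsets_at_top UNIV) \<and>
        (\<forall>F G. P F \<and> P G \<longrightarrow> dist (S h F) (S h G) < e)" if "e > 0" for e :: real
    proof -
      have "(sum (\<lambda>x. (cmod (ell2_coeff h x))\<^sup>2) \<longlongrightarrow> (norm h)\<^sup>2) (finite_subsets_at_top UNIV)"
        unfolding norm_ell2_sq by (rule infsum_tendsto[OF ell2_coeff_summable])
      then have "\<forall>\<^sub>F F in finite_subsets_at_top UNIV.
          dist (\<Sum>x\<in>F. (cmod (ell2_coeff h x))\<^sup>2) ((norm h)\<^sup>2) < (e / 2)\<^sup>2"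
        using \<open>e > 0\<close> by (intro tendstoD) auto
      then obtain K where K: "finite K"
        "\<And>F. finite F \<Longrightarrow> K \<subseteq> F \<Longrightarrow> dist (\<Sum>x\<in>F. (cmod (ell2_coeff h x))\<^sup>2) ((norm h)\<^sup>2) < (e / 2)\<^sup>2"
        unfolding eventually_finite_subsets_at_top by auto
      have near: "dist (S h F) (S h K) < e / 2" if F: "finite F" "K \<subseteq> F" for F
      proof -
        have "S h F - S h K = S h (F - K)"
          using F unfolding S_def by (simp add: sum_diff)
        then have "(dist (S h F) (S h K))\<^sup>2 = (\<Sum>x\<in>F - K. (cmod (ell2_coeff h x))\<^sup>2)"
          using norm_S[of "F - K" h] F by (simp add: dist_norm)
        also have "\<dots> = (\<Sum>x\<in>F. (cmod (ell2_coeff h x))\<^sup>2) - (\<Sum>x\<in>K. (cmod (ell2_coeff h x))\<^sup>2)"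
          using F by (simp add: sum_diff)
        also have "\<dots> < (e / 2)\<^sup>2"
          using K(2)[OF K(1)] finite_sum_le_norm_ell2[OF F(1), of h] by (simp add: dist_real_def)
        finally show ?thesis
          using \<open>e > 0\<close> by (intro power_less_imp_less_base[of _ 2 "e / 2"]) auto
      qed
      have "dist (S h F) (S h G) < e" if "finite F" "K \<subseteq> F" "finite G" "K \<subseteq> G" for F G
        using near[of F] near[of G] that dist_triangle2[of "S h F" "S h G" "S h K"] by linarith
      then show ?thesis
        by (intro exI[of _ "\<lambda>F. finite F \<and> K \<subseteq> F"])
           (use K(1) in \<open>auto simp: eventually_finite_subsets_at_top\<close>)
    qed
    have "cauchy_filter (filtermap (S h) (finite_subsets_at_top UNIV))"
      using ev by (simp add: cauchy_filter_metric_filtermap)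
    moreover have "complete (UNIV :: 'b ell2 set)"
      by (meson Cauchy_convergent UNIV_I complete_def convergent_def)
    ultimately obtain L where "(S h \<longlongrightarrow> L) (finite_subsets_at_top UNIV)"
      using complete_uniform[where S = "UNIV :: 'b ell2 set"] by (force simp add: filterlim_def)
    then show ?thesis
      unfolding S_def summable_on_def has_sum_def by blast
  qed
  define W where "W h = (\<Sum>\<^sub>\<infinity>a. scaleC_ell2 (ell2_coeff h a) (u a))" for h
  have W: "((\<lambda>a. scaleC_ell2 (ell2_coeff h a) (u a)) has_sum W h) UNIV" for h
    unfolding W_def by (rule has_sum_infsum[OF summable])
  have norm_W: "norm (W h) = norm h" for h
  proof -
    have "((\<lambda>F. (norm (S h F))\<^sup>2) \<longlongrightarrow> (norm (W h))\<^sup>2) (finite_subsets_at_top UNIV)"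
      using W unfolding has_sum_def S_def by (intro tendsto_intros)
    moreover have "((\<lambda>F. (norm (S h F))\<^sup>2) \<longlongrightarrow> (norm h)\<^sup>2) (finite_subsets_at_top UNIV)"
      using infsum_tendsto[OF ell2_coeff_summable[of h]]
      unfolding norm_ell2_sq[symmetric]
      by (rule Lim_transform_eventually)
         (auto simp: norm_S eventually_finite_subsets_at_top)
    ultimately have "(norm (W h))\<^sup>2 = (norm h)\<^sup>2"
      using tendsto_unique finite_subsets_at_top_neq_bot by blast
    then show ?thesis by simp
  qed
  have "bounded_linear W"
  proof (rule bounded_linear_intro)
    fix x y :: "'a ell2" and r :: real
    have "((\<lambda>a. scaleC_ell2 (ell2_coeff (x + y) a) (u a)) has_sum W x + W y) UNIV"
      using has_sum_add[OF W[of x] W[of y]]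
      by (rule has_sum_cong[THEN iffD1, rotated]) (auto intro!: ell2_eqI simp: ell2_coeff_simps algebra_simps)
    then show "W (x + y) = W x + W y"
      using W[of "x + y"] has_sum_unique by blast
    have "((\<lambda>a. scaleC_ell2 (ell2_coeff (r *\<^sub>R x) a) (u a)) has_sum r *\<^sub>R W x) UNIV"
      using has_sum_bounded_linear[OF bounded_linear_scaleR_right W[of x], of r]
      by (rule has_sum_cong[THEN iffD1, rotated]) (auto intro!: ell2_eqI simp: ell2_coeff_simps algebra_simps)
    then show "W (r *\<^sub>R x) = r *\<^sub>R W x"
      using W[of "r *\<^sub>R x"] has_sum_unique by blast
    show "norm (W x) \<le> norm x * 1" by (simp add: norm_W)
  qed
  then have "blinfun_apply (Blinfun W) = W" by (rule bounded_linear_Blinfun_apply)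
  then show thesis using that[of "Blinfun W"] norm_W W by simp
qed


section \<open>Closed unital operator algebras\<close>

lemma blinfun_comp_id [simp]: "a o\<^sub>L id_blinfun = a" "id_blinfun o\<^sub>L a = a"
  by (rule blinfun_eqI; simp)+

lemma blinfun_comp_assoc: "(a o\<^sub>L b) o\<^sub>L c = a o\<^sub>L (b o\<^sub>L c)"
  by (rule blinfun_eqI) simp

lemma unital_op_algebra_generated: "unital_op_algebra (closed_algebra_generated S)"
  unfolding closed_algebra_generated_def unital_op_algebra_def by auto

lemma closed_closed_algebra_generated: "closed (closed_algebra_generated S)"
  unfolding closed_algebra_generated_def by (intro closed_Inter) auto

lemma generators_in_generated: "S \<subseteq> closed_algebra_generated S"
  unfolding closed_algebra_generated_def by auto

lemma generated_least:
  "unital_op_algebra B \<Longrightarrow> closed B \<Longrightarrow> S \<subseteq> B \<Longrightarrow> closed_algebra_generated S \<subseteq> B"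
  unfolding closed_algebra_generated_def by auto

lemma scale_minus_one: "- 1 *\<^sub>o a = - a"
  by (rule blinfun_eqI, rule ell2_eqI) (simp add: ell2_coeff_simps blinfun.minus_left)

lemma unital_op_algebraD:
  assumes "unital_op_algebra A"
  shows unital_id: "id_blinfun \<in> A"
    and unital_add: "a \<in> A \<Longrightarrow> b \<in> A \<Longrightarrow> a + b \<in> A"
    and unital_comp: "a \<in> A \<Longrightarrow> b \<in> A \<Longrightarrow> a o\<^sub>L b \<in> A"
    and unital_scale: "a \<in> A \<Longrightarrow> c *\<^sub>o a \<in> A"
  using assms by (auto simp: unital_op_algebra_def)

lemma unital_diff:
  assumes "unital_op_algebra A" "a \<in> A" "b \<in> A"
  shows "a - b \<in> A"
  using unital_add[OF assms(1,2) unital_scale[OF assms(1,3), of "- 1"]] by (simp add: scale_minus_one)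

lemma unital_zero: "unital_op_algebra A \<Longrightarrow> 0 \<in> A"
  using unital_diff[OF _ unital_id unital_id, of A] by simp

lemma unital_sum:
  assumes "unital_op_algebra A" "\<And>i. i \<in> F \<Longrightarrow> f i \<in> A"
  shows "sum f F \<in> A"
  using assms(2) by (induction F rule: infinite_finite_induct)
    (auto intro: unital_zero[OF assms(1)] unital_add[OF assms(1)])

text \<open>
  The operator type consists of real linear maps, so commutation with complex scalars has to be
  carried as a property.
\<close>

definition complex_linear_op :: "('a ell2 \<Rightarrow>\<^sub>L 'b ell2) \<Rightarrow> bool"
  where "complex_linear_op a \<longleftrightarrow>
    (\<forall>c x. blinfun_apply a (scaleC_ell2 c x) = scaleC_ell2 c (blinfun_apply a x))"

lemma complex_linear_opD:
  "complex_linear_op a \<Longrightarrow> blinfun_apply a (scaleC_ell2 c x) = scaleC_ell2 c (blinfun_apply a x)"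
  by (simp add: complex_linear_op_def)

lemma bounded_linear_scaleC: "bounded_linear (scaleC_ell2 c)"
  using blinfun.bounded_linear_right[of "scalar_op c"] by simp

text \<open>
  Neumann series: it is the closedness of the algebra that makes the inverse an element of it.
\<close>

lemma neumann_inverse:
  fixes a :: "'a ell2 \<Rightarrow>\<^sub>L 'a ell2"
  assumes A: "unital_op_algebra A" "closed A" and a: "a \<in> A" "norm a < 1"
  obtains r where "r \<in> A" "r o\<^sub>L (id_blinfun - a) = id_blinfun" "(id_blinfun - a) o\<^sub>L r = id_blinfun"
proof -
  define p where "p k = ((\<lambda>b. a o\<^sub>L b) ^^ k) id_blinfun" for k
  have p0: "p 0 = id_blinfun" and pS: "p (Suc k) = a o\<^sub>L p k" for k
    by (auto simp: p_def)
  have p_comm: "p k o\<^sub>L a = a o\<^sub>L p k" for k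
    by (induction k) (auto simp: p0 pS blinfun_comp_assoc)
  have pA: "p k \<in> A" for k
    by (induction k) (auto simp: p0 pS intro: unital_id unital_comp A a)
  have norm_p: "norm (p k) \<le> norm a ^ k" for k
  proof (induction k)
    case 0
    then show ?case by (simp add: p0 norm_blinfun_id_le)
  next
    case (Suc k)
    have "norm (p (Suc k)) \<le> norm a * norm (p k)" unfolding pS by (rule norm_blinfun_compose)
    also have "\<dots> \<le> norm a * norm a ^ k" by (intro mult_left_mono Suc) auto
    finally show ?case by simp
  qed
  have "summable p"
    by (rule summable_comparison_test'[OF summable_geometric[of "norm a"]]) (use norm_p a in auto)
  then have sums: "p sums (\<Sum>k. p k)" by (rule summable_sums)
  define r where "r = (\<Sum>k. p k)"
  have "(\<lambda>n. \<Sum>k<n. p k) \<longlonglongrightarrow> r" using sums by (simp add: sums_def r_def)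
  then have rA: "r \<in> A"
    by (rule closed_sequentially[OF A(2), rotated]) (auto intro: unital_sum A pA)
  have "(\<lambda>k. p (Suc k)) sums (r - id_blinfun)"
    using sums by (subst sums_Suc_iff) (simp add: p0 r_def)
  moreover have "(\<lambda>k. p (Suc k)) sums (a o\<^sub>L r)"
    unfolding pS r_def
    by (rule bounded_linear.sums[OF bounded_bilinear.bounded_linear_right[OF bounded_bilinear_blinfun_compose] sums])
  moreover have "(\<lambda>k. p (Suc k)) sums (r o\<^sub>L a)"
    unfolding pS r_def p_comm[symmetric]
    by (rule bounded_linear.sums[OF bounded_bilinear.bounded_linear_left[OF bounded_bilinear_blinfun_compose] sums])
  ultimately have "a o\<^sub>L r = r - id_blinfun" "r o\<^sub>L a = r - id_blinfun"
    using sums_unique2 by blast+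
  then have "r o\<^sub>L (id_blinfun - a) = id_blinfun" "(id_blinfun - a) o\<^sub>L r = id_blinfun"
    by (auto simp: bounded_bilinear.diff_left[OF bounded_bilinear_blinfun_compose]
        bounded_bilinear.diff_right[OF bounded_bilinear_blinfun_compose])
  with rA show thesis by (rule that)
qed


section \<open>Row isometries\<close>

text \<open>
  This is \<open>V\<^sub>i\<^sup>* V\<^sub>j = \<delta>\<^sub>i\<^sub>j\<close>, written without adjoints. For complex linear \<open>V\<^sub>i\<close> the real inner product
  determines the complex one.
\<close>

definition row_isometry :: "('n \<Rightarrow> 'a ell2 \<Rightarrow>\<^sub>L 'a ell2) \<Rightarrow> bool"
  where "row_isometry V \<longleftrightarrow> (\<forall>i. complex_linear_op (V i)) \<and>
    (\<forall>i j x y. blinfun_apply (V i) x \<bullet> blinfun_apply (V j) y = (if i = j then x \<bullet> y else 0))"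

text \<open>
  The operator counterpart of the linear form \<open>z \<mapsto> \<langle>z, l\<rangle>\<close>. On a row isometry it is \<open>\<parallel>l\<parallel>\<close> times an
  isometry, hence a strict contraction for \<open>l\<close> in the open ball.
\<close>

definition row_comb :: "complex ^ 'n::finite \<Rightarrow> ('n \<Rightarrow> 'a ell2 \<Rightarrow>\<^sub>L 'a ell2) \<Rightarrow> 'a ell2 \<Rightarrow>\<^sub>L 'a ell2"
  where "row_comb l V = (\<Sum>j\<in>UNIV. cnj (l $ j) *\<^sub>o V j)"

lemma row_comb_apply:
  "blinfun_apply (row_comb l V) x = (\<Sum>j\<in>UNIV. scaleC_ell2 (cnj (l $ j)) (blinfun_apply (V j) x))"
  by (simp add: row_comb_def blinfun.sum_left)

lemma row_comb_in:
  "unital_op_algebra A \<Longrightarrow> (\<And>j. V j \<in> A) \<Longrightarrow> row_comb l V \<in> A"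
  unfolding row_comb_def by (intro unital_sum unital_scale)

lemma row_isometryD:
  assumes "row_isometry V"
  shows "complex_linear_op (V i)"
    and "blinfun_apply (V i) x \<bullet> blinfun_apply (V j) y = (if i = j then x \<bullet> y else 0)"
  using assms by (auto simp: row_isometry_def)

lemma inner_row_comb:
  assumes V: "row_isometry V"
  shows "blinfun_apply (V i) x \<bullet> blinfun_apply (row_comb l V) y = scaleC_ell2 (l $ i) x \<bullet> y"
proof -
  have "scaleC_ell2 (cnj (l $ j)) (blinfun_apply (V j) y) =
      blinfun_apply (V j) (scaleC_ell2 (cnj (l $ j)) y)" for j
    by (rule complex_linear_opD[OF row_isometryD(1)[OF V], symmetric])
  then show ?thesis
    by (simp add: row_comb_apply inner_sum_right row_isometryD(2)[OF V] inner_scaleC_left)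
qed

lemma norm_vec_sq: "(norm l)\<^sup>2 = (\<Sum>j\<in>UNIV. (cmod (l $ j))\<^sup>2)" for l :: "complex ^ 'n::finite"
  by (simp add: norm_vec_def L2_set_def sum_nonneg)

lemma row_comb_inner_row_comb:
  assumes V: "row_isometry V"
  shows "blinfun_apply (row_comb l V) x \<bullet> blinfun_apply (row_comb l V) y = (norm l)\<^sup>2 * (x \<bullet> y)"
proof -
  have "blinfun_apply (row_comb l V) x \<bullet> blinfun_apply (row_comb l V) y =
     (\<Sum>j\<in>UNIV. blinfun_apply (V j) (scaleC_ell2 (cnj (l $ j)) x) \<bullet> blinfun_apply (row_comb l V) y)"
    by (subst row_comb_apply) (simp add: inner_sum_left complex_linear_opD[OF row_isometryD(1)[OF V]])
  also have "\<dots> = (\<Sum>j\<in>UNIV. (cmod (l $ j))\<^sup>2 * (x \<bullet> y))"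
    by (simp add: inner_row_comb[OF V] complex_norm_square[symmetric] scaleC_of_real
        del: of_real_power)
  also have "\<dots> = (norm l)\<^sup>2 * (x \<bullet> y)"
    by (simp add: norm_vec_sq sum_distrib_right)
  finally show ?thesis .
qed

lemma norm_row_comb_le:
  assumes V: "row_isometry V"
  shows "norm (row_comb l V) \<le> norm l"
proof (rule norm_blinfun_bound)
  fix x
  have "(norm (blinfun_apply (row_comb l V) x))\<^sup>2 = (norm l * norm x)\<^sup>2"
    using row_comb_inner_row_comb[OF V, of l x x] by (simp add: power2_norm_eq_inner power_mult_distrib)
  then show "norm (blinfun_apply (row_comb l V) x) \<le> norm l * norm x"
    by (simp add: power2_eq_iff_nonneg)
qed simp

lemma row_comb_resolvent:
  assumes "unital_op_algebra A" "closed A" "row_isometry V" "\<And>j. V j \<in> A" "norm l < 1"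
  obtains r where "r \<in> A" "r o\<^sub>L (id_blinfun - row_comb l V) = id_blinfun"
    "(id_blinfun - row_comb l V) o\<^sub>L r = id_blinfun"
proof -
  have "norm (row_comb l V) < 1" using norm_row_comb_le[OF assms(3), of l] assms(5) by simp
  from neumann_inverse[OF assms(1,2) row_comb_in[of A V, OF assms(1,4)] this] that
  show thesis by blast
qed


section \<open>Contractive homomorphisms of operator algebras\<close>

definition contractive_hom ::
    "('a ell2 \<Rightarrow>\<^sub>L 'a ell2) set \<Rightarrow> (('a ell2 \<Rightarrow>\<^sub>L 'a ell2) \<Rightarrow> ('a ell2 \<Rightarrow>\<^sub>L 'a ell2)) \<Rightarrow> bool"
  where "contractive_hom A \<Psi> \<longleftrightarrow> \<Psi> id_blinfun = id_blinfun \<and>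
    (\<forall>a\<in>A. \<Psi> a \<in> A \<and> norm (\<Psi> a) \<le> norm a) \<and>
    (\<forall>a\<in>A. \<forall>b\<in>A. \<Psi> (a + b) = \<Psi> a + \<Psi> b \<and> \<Psi> (a o\<^sub>L b) = \<Psi> a o\<^sub>L \<Psi> b) \<and>
    (\<forall>c. \<forall>a\<in>A. \<Psi> (c *\<^sub>o a) = c *\<^sub>o \<Psi> a)"

lemma contractive_homD:
  assumes "contractive_hom A \<Psi>"
  shows "\<Psi> id_blinfun = id_blinfun"
    and "a \<in> A \<Longrightarrow> \<Psi> a \<in> A"
    and "a \<in> A \<Longrightarrow> norm (\<Psi> a) \<le> norm a"
    and "a \<in> A \<Longrightarrow> b \<in> A \<Longrightarrow> \<Psi> (a + b) = \<Psi> a + \<Psi> b"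
    and "a \<in> A \<Longrightarrow> b \<in> A \<Longrightarrow> \<Psi> (a o\<^sub>L b) = \<Psi> a o\<^sub>L \<Psi> b"
    and "a \<in> A \<Longrightarrow> \<Psi> (c *\<^sub>o a) = c *\<^sub>o \<Psi> a"
  using assms by (auto simp: contractive_hom_def)

lemma contractive_hom_diff:
  assumes "unital_op_algebra A" "contractive_hom A \<Psi>" "a \<in> A" "b \<in> A"
  shows "\<Psi> (a - b) = \<Psi> a - \<Psi> b"
  using contractive_homD(4)[OF assms(2) unital_diff[OF assms(1,3,4)] assms(4)] by (simp add: algebra_simps)

lemma contractive_hom_sum:
  assumes "unital_op_algebra A" "contractive_hom A \<Psi>" "\<And>i. i \<in> F \<Longrightarrow> f i \<in> A"
  shows "\<Psi> (sum f F) = (\<Sum>i\<in>F. \<Psi> (f i))"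
proof -
  have z: "\<Psi> 0 = 0"
    using contractive_hom_diff[OF assms(1,2) unital_id unital_id] assms(1) by simp
  show ?thesis
    using assms(3)
    by (induction F rule: infinite_finite_induct)
       (auto simp: z contractive_homD(4)[OF assms(2)] unital_sum[OF assms(1)])
qed

lemma contractive_hom_row_comb:
  assumes "unital_op_algebra A" "contractive_hom A \<Psi>" "\<And>j. V j \<in> A"
  shows "\<Psi> (row_comb l V) = row_comb l (\<lambda>j. \<Psi> (V j))"
  unfolding row_comb_def
  by (simp add: contractive_hom_sum[OF assms(1,2)] unital_scale[OF assms(1)] assms(3)
      contractive_homD(6)[OF assms(2)])

lemma contractive_hom_id: "contractive_hom A (\<lambda>a. a)"
  by (simp add: contractive_hom_def)

lemma contractive_hom_comp:
  assumes "contractive_hom A \<Psi>" "contractive_hom A \<Phi>"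
  shows "contractive_hom A (\<lambda>a. \<Psi> (\<Phi> a))"
  using assms unfolding contractive_hom_def by (auto intro: order_trans)

lemma continuous_on_contractive_hom:
  assumes "unital_op_algebra A" "contractive_hom A \<Psi>"
  shows "continuous_on A \<Psi>"
proof (rule lipschitz_on_continuous_on)
  show "1-lipschitz_on A \<Psi>"
  proof (rule lipschitz_onI)
    fix a b assume "a \<in> A" "b \<in> A"
    then show "dist (\<Psi> a) (\<Psi> b) \<le> 1 * dist a b"
      using contractive_homD(3)[OF assms(2) unital_diff[OF assms(1)], of a b]
      by (simp add: dist_norm contractive_hom_diff[OF assms])
  qed simp
qed

text \<open>
  Contractive homomorphisms are continuous, so the elements on which two of them agree form a closed
  algebra.
\<close>

lemma contractive_hom_eqI:
  assumes A: "A = closed_algebra_generated S"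
    and \<Psi>: "contractive_hom A \<Psi>" and \<Phi>: "contractive_hom A \<Phi>"
    and eq: "\<And>a. a \<in> S \<Longrightarrow> \<Psi> a = \<Phi> a" and a: "a \<in> A"
  shows "\<Psi> a = \<Phi> a"
proof -
  have uA: "unital_op_algebra A" and cA: "closed A"
    unfolding A by (rule unital_op_algebra_generated closed_closed_algebra_generated)+
  have "closed {a \<in> A. \<Psi> a - \<Phi> a = 0}"
    by (intro continuous_closed_preimage_constant continuous_on_diff continuous_on_contractive_hom
        uA cA \<Psi> \<Phi>)
  then have "closed {a \<in> A. \<Psi> a = \<Phi> a}" by simp
  moreover have "unital_op_algebra {a \<in> A. \<Psi> a = \<Phi> a}"
    unfolding unital_op_algebra_def
    by (auto simp: unital_op_algebraD[OF uA] contractive_homD[OF \<Psi>] contractive_homD[OF \<Phi>])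
  moreover have "S \<subseteq> {a \<in> A. \<Psi> a = \<Phi> a}"
    using eq generators_in_generated A by blast
  ultimately have "A \<subseteq> {a \<in> A. \<Psi> a = \<Phi> a}"
    using generated_least A by metis
  with a show ?thesis by auto
qed

text \<open>
  A contraction with a contractive inverse is isometric. This reduces isometry to the one-sided norm
  estimate, which is all that compression to a subspace can give.
\<close>

lemma isometric_automorphismI:
  assumes \<Psi>: "contractive_hom A \<Psi>" and \<Phi>: "contractive_hom A \<Phi>"
    and inv: "\<And>a. a \<in> A \<Longrightarrow> \<Psi> (\<Phi> a) = a" "\<And>a. a \<in> A \<Longrightarrow> \<Phi> (\<Psi> a) = a"
  shows "isometric_automorphism A \<Psi>"
proof -
  have "bij_betw \<Psi> A A"
    by (rule bij_betw_byWitness[where f' = \<Phi>])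
       (use inv contractive_homD(2)[OF \<Psi>] contractive_homD(2)[OF \<Phi>] in auto)
  moreover have "norm (\<Psi> a) = norm a" if "a \<in> A" for a
    using contractive_homD(3)[OF \<Psi> that] contractive_homD(3)[OF \<Phi> contractive_homD(2)[OF \<Psi> that]]
      inv(2)[OF that] by simp
  ultimately show ?thesis
    unfolding isometric_automorphism_def using contractive_homD(4-6)[OF \<Psi>] by blast
qed

lemma isometric_automorphism_contractive_hom:
  assumes "unital_op_algebra A" "isometric_automorphism A \<Psi>"
  shows "contractive_hom A \<Psi>"
proof -
  have bij: "bij_betw \<Psi> A A" using assms(2) by (simp add: isometric_automorphism_def)
  (* Psi is onto: if Psi e = 1, then 1 = Psi (1 e) = Psi 1 Psi e = Psi 1 *)
  obtain e where e: "e \<in> A" "\<Psi> e = id_blinfun"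
    using bij unital_id[OF assms(1)] by (metis bij_betw_imp_surj_on imageE)
  have "\<Psi> (id_blinfun o\<^sub>L e) = \<Psi> id_blinfun o\<^sub>L \<Psi> e"
    using assms(2) unital_id[OF assms(1)] e(1) unfolding isometric_automorphism_def by blast
  then have "\<Psi> id_blinfun = id_blinfun" by (simp add: e)
  then show ?thesis
    using assms(2) bij_betwE[OF bij] unfolding isometric_automorphism_def contractive_hom_def by simp
qed


section \<open>Homomorphisms of the noncommutative disc algebra from wandering vectors\<close>

lemma unital_nc: "unital_op_algebra nc_disc_algebra"
  and closed_nc: "closed nc_disc_algebra"
  and creation_in_nc: "creation i \<in> nc_disc_algebra"
  unfolding nc_disc_algebra_def
  using unital_op_algebra_generated closed_closed_algebra_generated generators_in_generated by blast+

lemma inner_basis_ell2: "basis_ell2 w \<bullet> y = Re (ell2_coeff y w)"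
proof -
  have "basis_ell2 w \<bullet> y = (\<Sum>\<^sub>\<infinity>x\<in>{w}. Re (ell2_coeff y w))"
    unfolding inner_ell2_def by (rule infsum_cong_neutral) (auto simp: basis_ell2.rep_eq)
  then show ?thesis by simp
qed

lemma inner_vacuum_creation: "basis_ell2 [] \<bullet> blinfun_apply (creation j) y = 0"
  by (simp add: inner_basis_ell2 creation.rep_eq creation_fun.rep_eq creation_coeff_def)

lemma row_isometry_creation: "row_isometry creation"
  unfolding row_isometry_def
proof (intro conjI allI)
  fix i :: 'a
  show "complex_linear_op (creation i)"
    unfolding complex_linear_op_def
    by (intro allI ell2_eqI)
       (simp add: creation.rep_eq creation_fun.rep_eq creation_coeff_def ell2_coeff_simps split: list.split)
next
  fix i j :: 'a and x y
  have "blinfun_apply (creation i) x \<bullet> blinfun_apply (creation j) y =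
      (\<Sum>\<^sub>\<infinity>w\<in>range (Cons i). creation_coeff i (ell2_coeff x) w \<bullet> creation_coeff j (ell2_coeff y) w)"
    unfolding inner_ell2_def creation.rep_eq creation_fun.rep_eq
    by (rule infsum_cong_neutral) (auto simp: creation_coeff_def split: list.splits)
  also have "\<dots> = (\<Sum>\<^sub>\<infinity>w. if i = j then ell2_coeff x w \<bullet> ell2_coeff y w else 0)"
    by (subst infsum_reindex) (auto simp: o_def creation_coeff_def intro!: infsum_cong)
  also have "\<dots> = (if i = j then x \<bullet> y else 0)"
    by (simp add: inner_ell2_def)
  finally show "blinfun_apply (creation i) x \<bullet> blinfun_apply (creation j) y = (if i = j then x \<bullet> y else 0)" .
qed

text \<open>
  Write \<open>V\<^sub>w\<close> for the product of the \<open>V\<^sub>i\<close> along a word \<open>w\<close>. A unit vector \<open>\<eta>\<close> orthogonal to the ranges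
  of all \<open>V\<^sub>i\<close> is wandering: the vectors \<open>V\<^sub>w \<eta>\<close> are orthonormal. Sending \<open>\<xi>\<^sub>w\<close> to \<open>V\<^sub>w \<eta>\<close> therefore extends to
  an isometry, under which prefixing the letter \<open>i\<close> corresponds to applying \<open>V\<^sub>i\<close>.
\<close>

lemma intertwining_isometry:
  fixes V :: "'n::finite \<Rightarrow> 'a ell2 \<Rightarrow>\<^sub>L 'a ell2"
  assumes V: "row_isometry V" and \<eta>: "norm \<eta> = 1" "\<And>j y. \<eta> \<bullet> blinfun_apply (V j) y = 0"
  obtains W :: "'n list ell2 \<Rightarrow>\<^sub>L 'a ell2"
  where "\<And>h. norm (blinfun_apply W h) = norm h" "complex_linear_op W"
    and "\<And>i. V i o\<^sub>L W = W o\<^sub>L creation i"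
proof -
  define u where "u w = foldr (\<lambda>i. blinfun_apply (V i)) w \<eta>" for w
  have u_simps: "u [] = \<eta>" "u (i # w) = blinfun_apply (V i) (u w)" for i w
    by (simp_all add: u_def)
  note lin = complex_linear_opD[OF row_isometryD(1)[OF V]]
  have wander: "scaleC_ell2 c \<eta> \<bullet> scaleC_ell2 d (blinfun_apply (V j) y) = 0" for c d j y
    by (simp add: inner_scaleC_left lin[symmetric] \<eta>(2))
  have orth: "scaleC_ell2 c (u v) \<bullet> scaleC_ell2 d (u w) = (if v = w then c \<bullet> d else 0)" for v w c d
  proof (induction v arbitrary: w c d)
    case Nil
    then show ?case by (cases w) (simp_all add: u_simps wander inner_scaleC_self \<eta>(1))
  next
    case (Cons i v)
    show ?case
    proof (cases w)
      case Nil
      then show ?thesis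
        using wander[of d c i "u v"] by (simp add: u_simps inner_commute)
    next
      case (Cons j w')
      show ?thesis
        unfolding Cons u_simps lin[symmetric] row_isometryD(2)[OF V] Cons.IH by simp
    qed
  qed
  obtain W :: "'n list ell2 \<Rightarrow>\<^sub>L 'a ell2" where W: "\<And>h. norm (blinfun_apply W h) = norm h"
    "\<And>h. ((\<lambda>w. scaleC_ell2 (ell2_coeff h w) (u w)) has_sum blinfun_apply W h) UNIV"
    using orthonormal_isometry[of u, OF orth] by metis
  have "blinfun_apply W (scaleC_ell2 c h) = scaleC_ell2 c (blinfun_apply W h)" for c h
    using has_sum_bounded_linear[OF bounded_linear_scaleC W(2)[of h], of c] W(2)[of "scaleC_ell2 c h"]
    by (simp add: ell2_coeff_simps) (metis has_sum_unique)
  then have lin_W: "complex_linear_op W" by (simp add: complex_linear_op_def)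
  have "blinfun_apply (V i) (blinfun_apply W h) = blinfun_apply W (blinfun_apply (creation i) h)" for i h
  proof -
    let ?g = "\<lambda>w. scaleC_ell2 (ell2_coeff (blinfun_apply (creation i) h) w) (u w)"
    have "((\<lambda>w. blinfun_apply (V i) (scaleC_ell2 (ell2_coeff h w) (u w))) has_sum
        blinfun_apply (V i) (blinfun_apply W h)) UNIV"
      by (rule has_sum_bounded_linear[OF blinfun.bounded_linear_right W(2)])
    then have "(?g has_sum blinfun_apply (V i) (blinfun_apply W h)) (range (Cons i))"
      by (subst has_sum_reindex)
         (auto simp: o_def u_simps lin creation.rep_eq creation_fun.rep_eq creation_coeff_def)
    moreover have "?g w = 0" if "w \<notin> range (Cons i)" for w
      using that
      by (auto simp: creation.rep_eq creation_fun.rep_eq creation_coeff_def ell2_coeff_simps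
          intro!: ell2_eqI split: list.splits)
    ultimately have "(?g has_sum blinfun_apply (V i) (blinfun_apply W h)) UNIV"
      by (subst has_sum_cong_neutral[where T = "range (Cons i)"]) auto
    then show ?thesis using W(2) has_sum_unique by blast
  qed
  then have "V i o\<^sub>L W = W o\<^sub>L creation i" for i
    by (intro blinfun_eqI) simp
  with W(1) lin_W show thesis by (rule that)
qed

text \<open>
  The relation \<open>a W = W c\<close> is compatible with sums and products. Since \<open>W\<close> is isometric, \<open>c\<close> is
  determined by \<open>a\<close> and \<open>\<parallel>c\<parallel> \<le> \<parallel>a\<parallel>\<close>. As \<open>V\<^sub>i W = W L\<^sub>i\<close>, every \<open>a\<close> in the algebra generated by the \<open>V\<^sub>i\<close> has
  such a \<open>c\<close>, and \<open>a \<mapsto> c\<close> is a contractive homomorphism undoing \<open>L\<^sub>i \<mapsto> V\<^sub>i\<close>. The inequality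
  \<open>\<parallel>p(L)\<parallel> \<le> \<parallel>p(V)\<parallel>\<close> thus comes without any dilation theory.
\<close>

lemma contractive_hom_of_wandering_vector:
  fixes V :: "'n::finite \<Rightarrow> 'n list ell2 \<Rightarrow>\<^sub>L 'n list ell2"
  assumes V: "row_isometry V" and \<eta>: "norm \<eta> = 1" "\<And>j y. \<eta> \<bullet> blinfun_apply (V j) y = 0"
    and gen: "nc_disc_algebra \<subseteq> closed_algebra_generated (range V)"
    and V_in: "\<And>i. V i \<in> nc_disc_algebra"
  obtains \<Psi> where "contractive_hom nc_disc_algebra \<Psi>" "\<And>i. \<Psi> (V i) = creation i"
proof -
  obtain W where iso: "\<And>h. norm (blinfun_apply W h) = norm h" and lin_W: "complex_linear_op W"
    and W: "\<And>i. V i o\<^sub>L W = W o\<^sub>L creation i"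
    using intertwining_isometry[OF V \<eta>] by metis
  have norm_le: "norm c \<le> norm a" if "a o\<^sub>L W = W o\<^sub>L c" for a c
  proof (rule norm_blinfun_bound)
    fix h
    have "norm (blinfun_apply c h) = norm (blinfun_apply (W o\<^sub>L c) h)" by (simp add: iso)
    also have "\<dots> = norm (blinfun_apply a (blinfun_apply W h))" by (simp flip: that)
    also have "\<dots> \<le> norm a * norm (blinfun_apply W h)" by (rule norm_blinfun)
    finally show "norm (blinfun_apply c h) \<le> norm a * norm h" by (simp add: iso)
  qed simp
  have comp_diff: "(a - b) o\<^sub>L W = W o\<^sub>L (c - d)" if "a o\<^sub>L W = W o\<^sub>L c" "b o\<^sub>L W = W o\<^sub>L d" for a b c d
    using that by (simp add: bounded_bilinear.diff_left[OF bounded_bilinear_blinfun_compose]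
        bounded_bilinear.diff_right[OF bounded_bilinear_blinfun_compose])
  have comp_add: "(a + b) o\<^sub>L W = W o\<^sub>L (c + d)" if "a o\<^sub>L W = W o\<^sub>L c" "b o\<^sub>L W = W o\<^sub>L d" for a b c d
    using that by (simp add: bounded_bilinear.add_left[OF bounded_bilinear_blinfun_compose]
        bounded_bilinear.add_right[OF bounded_bilinear_blinfun_compose])
  have comp_mult: "(a o\<^sub>L b) o\<^sub>L W = W o\<^sub>L (c o\<^sub>L d)" if "a o\<^sub>L W = W o\<^sub>L c" "b o\<^sub>L W = W o\<^sub>L d" for a b c d
    using that by (metis blinfun_comp_assoc)
  have comp_scale: "(k *\<^sub>o a) o\<^sub>L W = W o\<^sub>L (k *\<^sub>o c)" if "a o\<^sub>L W = W o\<^sub>L c" for a c k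
  proof (rule blinfun_eqI)
    fix h
    have "blinfun_apply a (blinfun_apply W h) = blinfun_apply W (blinfun_apply c h)"
      using that by (metis blinfun_apply_blinfun_compose)
    then show "blinfun_apply ((k *\<^sub>o a) o\<^sub>L W) h = blinfun_apply (W o\<^sub>L (k *\<^sub>o c)) h"
      by (simp add: complex_linear_opD[OF lin_W])
  qed
  let ?S = "{a. \<exists>c\<in>nc_disc_algebra. a o\<^sub>L W = W o\<^sub>L c}"
  have "unital_op_algebra ?S"
    unfolding unital_op_algebra_def
  proof (intro conjI ballI allI)
    show "id_blinfun \<in> ?S" using unital_id[OF unital_nc] by force
    show "a + b \<in> ?S" if "a \<in> ?S" "b \<in> ?S" for a b
      using that comp_add unital_add[OF unital_nc] by blast
    show "a o\<^sub>L b \<in> ?S" if "a \<in> ?S" "b \<in> ?S" for a b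
      using that comp_mult unital_comp[OF unital_nc] by blast
    show "k *\<^sub>o a \<in> ?S" if "a \<in> ?S" for a k
      using that comp_scale unital_scale[OF unital_nc] by blast
  qed
  moreover have "closed ?S"
    unfolding closed_sequential_limits
  proof (intro allI impI)
    fix f a assume f: "(\<forall>n. f n \<in> ?S) \<and> f \<longlonglongrightarrow> a"
    then have "\<forall>n. \<exists>c. c \<in> nc_disc_algebra \<and> f n o\<^sub>L W = W o\<^sub>L c" by blast
    from choice[OF this] obtain c
      where "\<forall>n. c n \<in> nc_disc_algebra \<and> f n o\<^sub>L W = W o\<^sub>L c n" ..
    then have c: "c n \<in> nc_disc_algebra" "f n o\<^sub>L W = W o\<^sub>L c n" for n by simp_all
    (* compressing by W does not increase distances, so the c n inherit the Cauchy property *)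
    have "Cauchy c"
    proof (rule metric_CauchyI)
      fix e :: real assume "e > 0"
      have "Cauchy f" using f by (auto intro: LIMSEQ_imp_Cauchy)
      from metric_CauchyD[OF this \<open>e > 0\<close>]
      obtain N where "\<forall>m\<ge>N. \<forall>n\<ge>N. dist (f m) (f n) < e" by auto
      moreover have "dist (c m) (c n) \<le> dist (f m) (f n)" for m n
        unfolding dist_norm by (rule norm_le[OF comp_diff[OF c(2) c(2)]])
      ultimately show "\<exists>N. \<forall>m\<ge>N. \<forall>n\<ge>N. dist (c m) (c n) < e"
        by (meson le_less_trans)
    qed
    then obtain l where l: "c \<longlonglongrightarrow> l" using Cauchy_convergent convergent_def by blast
    have "l \<in> nc_disc_algebra" by (rule closed_sequentially[OF closed_nc c(1) l])
    moreover have "(\<lambda>n. f n o\<^sub>L W) \<longlonglongrightarrow> (a o\<^sub>L W)" "(\<lambda>n. W o\<^sub>L c n) \<longlonglongrightarrow> (W o\<^sub>L l)"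
      using f l by (auto intro!: bounded_bilinear.tendsto[OF bounded_bilinear_blinfun_compose])
    then have "a o\<^sub>L W = W o\<^sub>L l" using c(2) LIMSEQ_unique by auto
    ultimately show "a \<in> ?S" by blast
  qed
  moreover have "range V \<subseteq> ?S" using W creation_in_nc by blast
  ultimately have "nc_disc_algebra \<subseteq> ?S"
    using gen generated_least by blast
  then have "\<forall>a. \<exists>c. a \<in> nc_disc_algebra \<longrightarrow> c \<in> nc_disc_algebra \<and> a o\<^sub>L W = W o\<^sub>L c" by blast
  from choice[OF this] obtain \<Psi> where
    "\<forall>a. a \<in> nc_disc_algebra \<longrightarrow> \<Psi> a \<in> nc_disc_algebra \<and> a o\<^sub>L W = W o\<^sub>L \<Psi> a" ..
  then have \<Psi>: "\<Psi> a \<in> nc_disc_algebra" "a o\<^sub>L W = W o\<^sub>L \<Psi> a" if "a \<in> nc_disc_algebra" for a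
    using that by simp_all
  have unique: "\<Psi> a = c" if "a \<in> nc_disc_algebra" "a o\<^sub>L W = W o\<^sub>L c" for a c
    using norm_le[OF comp_diff[OF \<Psi>(2)[OF that(1)] that(2)]] by simp
  have "contractive_hom nc_disc_algebra \<Psi>"
    unfolding contractive_hom_def
  proof (intro conjI ballI allI)
    show "\<Psi> id_blinfun = id_blinfun" by (rule unique) (auto intro: unital_id unital_nc)
    fix a b :: "'n list ell2 \<Rightarrow>\<^sub>L 'n list ell2" and k
    assume a: "a \<in> nc_disc_algebra"
    show "\<Psi> a \<in> nc_disc_algebra" by (rule \<Psi>(1)[OF a])
    show "norm (\<Psi> a) \<le> norm a" by (rule norm_le[OF \<Psi>(2)[OF a]])
    show "\<Psi> (k *\<^sub>o a) = k *\<^sub>o \<Psi> a"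
      by (intro unique unital_scale[OF unital_nc] comp_scale \<Psi>(2) a)
    assume b: "b \<in> nc_disc_algebra"
    show "\<Psi> (a + b) = \<Psi> a + \<Psi> b"
      by (intro unique unital_add[OF unital_nc] comp_add \<Psi>(2) a b)
    show "\<Psi> (a o\<^sub>L b) = \<Psi> a o\<^sub>L \<Psi> b"
      by (intro unique unital_comp[OF unital_nc] comp_mult \<Psi>(2) a b)
  qed
  moreover have "\<Psi> (V i) = creation i" for i by (rule unique[OF V_in W])
  ultimately show thesis by (rule that)
qed


section \<open>The coordinate shift automorphism\<close>

text \<open>
  A permuted row of creation operators is a row isometry with the same wandering vector \<open>\<xi>\<^bsub>[]\<^esub>\<close>. The
  homomorphism obtained from it sends \<open>V\<^sub>i\<close> to \<open>L\<^sub>i\<close>, so the row has to be permuted by the inverse.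
\<close>

lemma letter_permutation_hom:
  fixes \<sigma> :: "'n::finite \<Rightarrow> 'n"
  assumes \<sigma>: "\<sigma> permutes UNIV"
  obtains \<Psi> where "contractive_hom nc_disc_algebra \<Psi>" "\<And>i. \<Psi> (creation i) = creation (\<sigma> i)"
proof -
  define V where "V i = (creation (inv \<sigma> i) :: 'n list ell2 \<Rightarrow>\<^sub>L 'n list ell2)" for i
  have inj: "inv \<sigma> i = inv \<sigma> j \<longleftrightarrow> i = j" for i j
    using permutes_inj[OF permutes_inv[OF \<sigma>]] by (simp add: inj_eq)
  have "row_isometry V"
    using row_isometry_creation[where 'a = 'n] by (simp add: row_isometry_def V_def inj)
  moreover have "norm (basis_ell2 ([] :: 'n list)) = 1"
    "basis_ell2 [] \<bullet> blinfun_apply (V j) y = 0" for j y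
    by (simp_all add: V_def inner_vacuum_creation)
  moreover have "creation i = V (\<sigma> i)" for i
    by (simp add: V_def permutes_inverses[OF \<sigma>])
  then have "range creation \<subseteq> range V" by blast
  then have "nc_disc_algebra \<subseteq> closed_algebra_generated (range V)"
    unfolding nc_disc_algebra_def
    by (intro generated_least unital_op_algebra_generated closed_closed_algebra_generated)
       (use generators_in_generated in blast)
  moreover have "V i \<in> nc_disc_algebra" for i by (simp add: V_def creation_in_nc)
  ultimately obtain \<Psi> where \<Psi>: "contractive_hom nc_disc_algebra \<Psi>" "\<And>i. \<Psi> (V i) = creation i"
    using contractive_hom_of_wandering_vector by metis
  have "\<Psi> (creation i) = creation (\<sigma> i)" for i
    using \<Psi>(2)[of "\<sigma> i"] by (simp add: V_def permutes_inverses[OF \<sigma>])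
  with \<Psi>(1) show thesis by (rule that)
qed

lemmas nc_hom_eqI = contractive_hom_eqI[OF nc_disc_algebra_def]

lemma shift_automorphism_spec:
  fixes \<tau> :: "'n::finite \<Rightarrow> 'n"
  assumes \<tau>: "\<tau> permutes UNIV"
  shows "isometric_automorphism nc_disc_algebra (shift_automorphism \<tau>)"
    and "shift_automorphism \<tau> (creation i) = creation (\<tau> i)"
proof -
  let ?A = "nc_disc_algebra :: ('n list ell2 \<Rightarrow>\<^sub>L 'n list ell2) set"
  let ?P = "\<lambda>T. T \<in> extensional ?A \<and> isometric_automorphism ?A T \<and>
      (\<forall>i. T (creation i) = creation (\<tau> i))"
  obtain \<Psi> where \<Psi>: "contractive_hom ?A \<Psi>" "\<And>i. \<Psi> (creation i) = creation (\<tau> i)"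
    using letter_permutation_hom[OF \<tau>] by metis
  obtain \<Phi> where \<Phi>: "contractive_hom ?A \<Phi>" "\<And>i. \<Phi> (creation i) = creation (inv \<tau> i)"
    using letter_permutation_hom[OF permutes_inv[OF \<tau>]] by metis
  have "\<Psi> (\<Phi> a) = a" if "a \<in> ?A" for a
    by (rule nc_hom_eqI[OF contractive_hom_comp[OF \<Psi>(1) \<Phi>(1)] contractive_hom_id _ that])
       (auto simp: \<Psi> \<Phi> permutes_inverses[OF \<tau>])
  moreover have "\<Phi> (\<Psi> a) = a" if "a \<in> ?A" for a
    by (rule nc_hom_eqI[OF contractive_hom_comp[OF \<Phi>(1) \<Psi>(1)] contractive_hom_id _ that])
       (auto simp: \<Psi> \<Phi> permutes_inverses[OF \<tau>])
  ultimately have iso: "isometric_automorphism ?A \<Psi>"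
    by (rule isometric_automorphismI[OF \<Psi>(1) \<Phi>(1)])
  have "isometric_automorphism ?A (restrict \<Psi> ?A)"
    using iso unfolding isometric_automorphism_def
    by (simp add: unital_op_algebraD[OF unital_nc] cong: bij_betw_cong)
  then have ex: "?P (restrict \<Psi> ?A)"
    by (simp add: \<Psi>(2) creation_in_nc)
  have uniq: "T = T'" if "?P T" "?P T'" for T T'
  proof (rule extensionalityI)
    fix a assume a: "a \<in> ?A"
    have "contractive_hom ?A T" "contractive_hom ?A T'"
      using that by (blast intro: isometric_automorphism_contractive_hom[OF unital_nc])+
    then show "T a = T' a"
      by (rule nc_hom_eqI[OF _ _ _ a]) (use that in auto)
  qed (use that in auto)
  have "?P (shift_automorphism \<tau>)"
    unfolding shift_automorphism_def by (rule theI[where P = ?P, OF ex]) (rule uniq[OF _ ex])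
  then show "isometric_automorphism ?A (shift_automorphism \<tau>)"
    and "shift_automorphism \<tau> (creation i) = creation (\<tau> i)" by auto
qed


section \<open>Moebius involutions of the ball\<close>

definition cdot :: "complex ^ 'n::finite \<Rightarrow> complex ^ 'n \<Rightarrow> complex"
  where "cdot z l = (\<Sum>j\<in>UNIV. z $ j * cnj (l $ j))"

definition defect :: "complex ^ 'n::finite \<Rightarrow> complex"
  where "defect l = complex_of_real (sqrt (1 - (norm l)\<^sup>2))"

text \<open>
  The standard involution exchanging \<open>0\<close> and \<open>l\<close> is
  \<open>(l - P z - s (z - P z)) / (1 - \<langle>z, l\<rangle>)\<close> with \<open>P\<close> the orthogonal projection onto the line of \<open>l\<close> and
  \<open>s\<close> the defect. Since \<open>P z = \<langle>z, l\<rangle> l / \<parallel>l\<parallel>\<^sup>2\<close> and \<open>(1 - s) / \<parallel>l\<parallel>\<^sup>2 = 1 / (1 + s)\<close>, the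
  numerator takes the form below, which makes sense for \<open>l = 0\<close> as well.
\<close>

definition moebius :: "complex ^ 'n::finite \<Rightarrow> complex ^ 'n \<Rightarrow> complex ^ 'n"
  where "moebius l z =
    (\<chi> i. (l $ i * (1 - cdot z l / (1 + defect l)) - defect l * z $ i) / (1 - cdot z l))"

lemma cdot_self: "cdot l l = complex_of_real ((norm l)\<^sup>2)"
  by (simp only: cdot_def norm_vec_sq of_real_sum complex_norm_square)

lemma cnj_cdot: "cnj (cdot z l) = cdot l z"
  by (simp add: cdot_def mult.commute)

lemma norm_cdot_le: "cmod (cdot z l) \<le> norm z * norm l"
proof -
  have "cmod (cdot z l) \<le> (\<Sum>j\<in>UNIV. \<bar>cmod (z $ j)\<bar> * \<bar>cmod (l $ j)\<bar>)"
    unfolding cdot_def by (rule order_trans[OF norm_sum]) (simp add: norm_mult)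
  also have "\<dots> \<le> norm z * norm l"
    unfolding norm_vec_def by (rule L2_set_mult_ineq)
  finally show ?thesis .
qed

lemma one_minus_cdot_nonzero:
  assumes "norm l < 1" "norm z < 1"
  shows "1 - cdot z l \<noteq> 0"
proof
  assume "1 - cdot z l = 0"
  then have "1 \<le> norm z * norm l" using norm_cdot_le[of z l] by simp
  also have "\<dots> \<le> 1 * norm l" using assms by (intro mult_right_mono) auto
  finally show False using assms by simp
qed

lemma defect_props:
  assumes "norm l < 1"
  shows "(defect l)\<^sup>2 = 1 - cdot l l" "1 + defect l \<noteq> 0" "cnj (defect l) = defect l" "defect l \<noteq> 0"
proof -
  have pos: "0 < 1 - (norm l)\<^sup>2" using assms by (simp add: power_less_one_iff abs_square_less_1)
  then have "(sqrt (1 - (norm l)\<^sup>2))\<^sup>2 = 1 - (norm l)\<^sup>2" by simp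
  then show "(defect l)\<^sup>2 = 1 - cdot l l"
    unfolding defect_def cdot_self of_real_power[symmetric] by simp
  have "1 + sqrt (1 - (norm l)\<^sup>2) \<noteq> 0" using real_sqrt_gt_zero[OF pos] by linarith
  then show "1 + defect l \<noteq> 0"
    unfolding defect_def by (metis of_real_1 of_real_add of_real_eq_0_iff)
  show "cnj (defect l) = defect l" by (simp add: defect_def)
  show "defect l \<noteq> 0" using pos by (simp add: defect_def)
qed

lemma moebius_zero: "moebius l 0 = l"
  by (simp add: moebius_def cdot_def vec_eq_iff)

lemma cdot_scaled_diff: "(\<Sum>j\<in>UNIV. (l $ j * c - d * z $ j) * cnj (m $ j)) = c * cdot l m - d * cdot z m"
  unfolding cdot_def by (simp add: algebra_simps sum_subtractf sum_distrib_left)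

lemma cdot_scaled_diff_right:
  "(\<Sum>j\<in>UNIV. v $ j * (cnj (l $ j) * c - d * cnj (z $ j))) = c * cdot v l - d * cdot v z"
  unfolding cdot_def by (simp add: algebra_simps sum_subtractf sum_distrib_left)

text \<open>
  Along \<open>l\<close> the involution is a one-dimensional Moebius map. The formula shows that the denominators of
  two successive applications multiply to the constant \<open>s\<^sup>2\<close>.
\<close>

lemma one_minus_cdot_moebius:
  assumes l: "norm l < 1" and z: "norm z < 1"
  shows "1 - cdot (moebius l z) l = (defect l)\<^sup>2 / (1 - cdot z l)"
proof -
  let ?a = "cdot z l" and ?s = "defect l"
  note d = defect_props[OF l]
  have "cdot (moebius l z) l =
      (\<Sum>j\<in>UNIV. (l $ j * (1 - ?a / (1 + ?s)) - ?s * z $ j) * cnj (l $ j)) / (1 - ?a)"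
    unfolding cdot_def[of "moebius l z"] by (simp add: moebius_def sum_divide_distrib)
  also have "\<dots> = ((1 - ?a / (1 + ?s)) * cdot l l - ?s * ?a) / (1 - ?a)"
    by (simp only: cdot_scaled_diff)
  also have "(1 - ?a / (1 + ?s)) * cdot l l = (1 - ?a / (1 + ?s)) * ((1 + ?s) * (1 - ?s))"
  proof -
    have "cdot l l = (1 + ?s) * (1 - ?s)" using d(1) by algebra
    then show ?thesis by simp
  qed
  also have "\<dots> = (1 + ?s - ?a) * (1 - ?s)"
    using d(2) by (simp add: field_simps)
  finally have "cdot (moebius l z) l = ((1 + ?s - ?a) * (1 - ?s) - ?s * ?a) / (1 - ?a)" .
  then show ?thesis
    using one_minus_cdot_nonzero[OF l z] by (simp add: field_simps power2_eq_square)
qed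

text \<open>
  The reason is the identity
  \<open>1 - \<parallel>\<theta>(z)\<parallel>\<^sup>2 = (1 - \<parallel>l\<parallel>\<^sup>2) (1 - \<parallel>z\<parallel>\<^sup>2) / \<bar>1 - \<langle>z, l\<rangle>\<bar>\<^sup>2\<close> for \<open>\<theta> = moebius l\<close>, proved by expanding
  the squared norm of the numerator \<open>v\<close>.
\<close>

lemma norm_moebius:
  assumes l: "norm l < 1" and z: "norm z < 1"
  shows "norm (moebius l z) < 1"
proof -
  let ?a = "cdot z l" and ?s = "defect l" and ?k = "1 / (1 + defect l)"
  note d = defect_props[OF l] and nz = one_minus_cdot_nonzero[OF l z]
  define v where "v = (\<chi> j. l $ j * (1 - ?a * ?k) - ?s * z $ j)"
  have cnj_v: "cnj (v $ j) = cnj (l $ j) * (1 - cnj ?a * ?k) - ?s * cnj (z $ j)" for j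
    by (simp add: v_def d(3))
  have k: "?k * (1 + ?s) = 1" using d(2) by simp
  have "cdot v v = (\<Sum>j\<in>UNIV. v $ j * (cnj (l $ j) * (1 - cnj ?a * ?k) - ?s * cnj (z $ j)))"
    by (simp only: cdot_def cnj_v)
  also have "\<dots> = (1 - cnj ?a * ?k) * cdot v l - ?s * cdot v z"
    by (rule cdot_scaled_diff_right)
  also have "cdot v l = (1 - ?a * ?k) * cdot l l - ?s * ?a"
    unfolding cdot_def[of v] by (simp only: v_def vec_lambda_beta cdot_scaled_diff)
  also have "cdot v z = (1 - ?a * ?k) * cnj ?a - ?s * cdot z z"
    unfolding cdot_def[of v] by (simp only: v_def vec_lambda_beta cdot_scaled_diff cnj_cdot)
  also have "cdot l l = 1 - ?s\<^sup>2" using d(1) by simp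
  also have "(1 - cnj ?a * ?k) * ((1 - ?a * ?k) * (1 - ?s\<^sup>2) - ?s * ?a)
       - ?s * ((1 - ?a * ?k) * cnj ?a - ?s * cdot z z)
     = (1 - ?a) * (1 - cnj ?a) - ?s\<^sup>2 * (1 - cdot z z)"
    using k by algebra
  finally have "cdot v v = (1 - ?a) * cnj (1 - ?a) - ?s\<^sup>2 * (1 - cdot z z)" by simp
  then have "complex_of_real ((norm v)\<^sup>2) =
      complex_of_real ((cmod (1 - ?a))\<^sup>2 - (1 - (norm l)\<^sup>2) * (1 - (norm z)\<^sup>2))"
    unfolding complex_norm_square[symmetric] by (simp add: cdot_self d(1) del: of_real_power)
  then have "(norm v)\<^sup>2 = (cmod (1 - ?a))\<^sup>2 - (1 - (norm l)\<^sup>2) * (1 - (norm z)\<^sup>2)"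
    by (rule of_real_eq_iff[THEN iffD1])
  moreover have "0 < (1 - (norm l)\<^sup>2) * (1 - (norm z)\<^sup>2)"
    using l z by (intro mult_pos_pos) (simp_all add: abs_square_less_1)
  ultimately have "norm v < cmod (1 - ?a)"
    by (intro power_less_imp_less_base[of "norm v" 2]) auto
  moreover have "(norm (moebius l z))\<^sup>2 = (norm v / cmod (1 - ?a))\<^sup>2"
    unfolding norm_vec_sq power_divide
    by (simp add: moebius_def v_def norm_divide power_divide sum_divide_distrib)
  then have "norm (moebius l z) = norm v / cmod (1 - ?a)"
    by (simp add: power2_eq_iff_nonneg)
  ultimately show ?thesis using nz by simp
qed

lemma moebius_involution:
  assumes l: "norm l < 1" and z: "norm z < 1"
  shows "moebius l (moebius l z) = z"
proof -
  let ?a = "cdot z l" and ?s = "defect l" and ?k = "1 / (1 + defect l)"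
  note d = defect_props[OF l] and nz = one_minus_cdot_nonzero[OF l z]
  define b where "b = cdot (moebius l z) l"
  have b: "(1 - b) * (1 - ?a) = ?s\<^sup>2" and nb: "1 - b \<noteq> 0"
    using one_minus_cdot_moebius[OF l z] nz d(4) by (auto simp: b_def)
  have k: "?k * (1 + ?s) = 1" using d(2) by simp
  have "moebius l (moebius l z) $ i = z $ i" for i
  proof -
    let ?m = "moebius l z $ i"
    have m: "?m * (1 - ?a) = l $ i * (1 - ?a * ?k) - ?s * z $ i"
      using nz by (simp add: moebius_def)
    have "(1 - ?a) * (l $ i * (1 - b * ?k) - ?s * ?m) = (1 - ?a) * (z $ i * (1 - b))"
      using m b k by algebra
    then have "l $ i * (1 - b * ?k) - ?s * ?m = z $ i * (1 - b)"
      using nz by simp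
    then show ?thesis
      using nb by (simp add: moebius_def[of l "moebius l z"] b_def[symmetric] field_simps)
  qed
  then show ?thesis by (simp add: vec_eq_iff)
qed

lemma bounded_linear_cdot: "bounded_linear (\<lambda>z. cdot z l)"
  unfolding cdot_def by (intro bounded_linear_sum bounded_linear_mult_const bounded_linear_vec_nth)

lemma holomorphic_vec_on_componentwise:
  fixes f :: "complex ^ 'm::finite \<Rightarrow> complex ^ 'n::finite"
  assumes "\<And>z i. z \<in> S \<Longrightarrow>
    \<exists>D. ((\<lambda>z. f z $ i) has_derivative D) (at z) \<and> (\<forall>c v. D (c *s v) = c * D v)"
  shows "holomorphic_vec_on f S"
  unfolding holomorphic_vec_on_def
proof
  fix z assume "z \<in> S"
  from choice[OF allI[OF assms[OF this]]] obtain D where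
    D: "\<forall>i. ((\<lambda>z. f z $ i) has_derivative D i) (at z) \<and> (\<forall>c v. D i (c *s v) = c * D i v)" ..
  have "(f has_derivative (\<lambda>v. \<chi> i. D i v)) (at z)"
  proof (subst has_derivative_componentwise_within, rule ballI)
    fix b :: "complex ^ 'n" assume "b \<in> Basis"
    then obtain i u where "b = axis i u" by (auto simp: Basis_vec_def)
    then show "((\<lambda>x. f x \<bullet> b) has_derivative (\<lambda>x. (\<chi> i. D i x) \<bullet> b)) (at z)"
      using D by (simp add: inner_axis has_derivative_inner_left)
  qed
  moreover have "(\<chi> i. D i (c *s v)) = c *s (\<chi> i. D i v)" for c v
    using D by (simp add: vec_eq_iff)
  ultimately show "\<exists>D. (f has_derivative D) (at z) \<and> (\<forall>c v. D (c *s v) = c *s D v)" by blast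
qed

lemma holomorphic_moebius:
  assumes l: "norm l < 1"
  shows "holomorphic_vec_on (moebius l) (ball 0 1)"
proof (rule holomorphic_vec_on_componentwise)
  fix z :: "complex ^ 'a" and i assume "z \<in> ball 0 1"
  then have nz: "1 - cdot z l \<noteq> 0" using one_minus_cdot_nonzero[OF l] by simp
  let ?s = "defect l" and ?d = "1 - cdot z l"
  let ?N = "\<lambda>z. l $ i * (1 - cdot z l / (1 + ?s)) - ?s * z $ i"
  let ?N' = "\<lambda>v. l $ i * (- (cdot v l / (1 + ?s))) - ?s * v $ i"
  let ?D = "\<lambda>v. - ?N z * (inverse ?d * (- cdot v l) * inverse ?d) + ?N' v / ?d"
  have c: "((\<lambda>z. cdot z l) has_derivative (\<lambda>v. cdot v l)) (at z)"
    by (rule bounded_linear_imp_has_derivative[OF bounded_linear_cdot])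
  have n: "((\<lambda>z. z $ i) has_derivative (\<lambda>v. v $ i)) (at z)"
    by (rule bounded_linear_imp_has_derivative[OF bounded_linear_vec_nth])
  have den: "((\<lambda>z. 1 - cdot z l) has_derivative (\<lambda>v. - cdot v l)) (at z)"
    using has_derivative_diff[OF has_derivative_const c, of 1] by simp
  have "((\<lambda>z. cdot z l / (1 + ?s)) has_derivative (\<lambda>v. cdot v l / (1 + ?s))) (at z)"
    by (rule bounded_linear.has_derivative[OF bounded_linear_divide c])
  then have "((\<lambda>z. 1 - cdot z l / (1 + ?s)) has_derivative (\<lambda>v. - (cdot v l / (1 + ?s)))) (at z)"
    using has_derivative_diff[OF has_derivative_const, of _ _ "at z" 1] by fastforce
  then have num: "(?N has_derivative ?N') (at z)"
    by (intro has_derivative_diff has_derivative_mult_right n)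
  have "((\<lambda>z. moebius l z $ i) has_derivative ?D) (at z)"
    using has_derivative_divide[OF num den nz] by (simp add: moebius_def)
  moreover have lin: "cdot (c *s v) l = c * cdot v l" for c v
    by (simp add: cdot_def sum_distrib_left algebra_simps)
  have "?D (c *s v) = c * ?D v" for c v
    unfolding lin using nz by (simp add: divide_inverse algebra_simps)
  ultimately show "\<exists>D. ((\<lambda>z. moebius l z $ i) has_derivative D) (at z) \<and> (\<forall>c v. D (c *s v) = c * D v)"
    by blast
qed

lemma ball_automorphism_of_involution:
  assumes maps: "\<And>z. z \<in> ball 0 1 \<Longrightarrow> f z \<in> ball 0 1"
    and inv: "\<And>z. z \<in> ball 0 1 \<Longrightarrow> f (f z) = z"
    and hol: "holomorphic_vec_on f (ball 0 1)"
  shows "ball_automorphism f"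
proof -
  have bij: "bij_betw f (ball 0 1) (ball 0 1)"
    by (rule bij_betw_byWitness[where f' = f]) (use maps inv in auto)
  have eq: "inv_into (ball 0 1) f z = f z" if "z \<in> ball 0 1" for z
    by (rule inv_into_f_eq[OF bij_betw_imp_inj_on[OF bij]]) (use maps inv that in auto)
  have "holomorphic_vec_on (inv_into (ball 0 1) f) (ball 0 1)"
    unfolding holomorphic_vec_on_def
  proof
    fix z :: "complex ^ 'a" assume z: "z \<in> ball 0 1"
    then obtain D where D: "(f has_derivative D) (at z)" "\<forall>c v. D (c *s v) = c *s D v"
      using hol unfolding holomorphic_vec_on_def by blast
    have "(inv_into (ball 0 1) f has_derivative D) (at z)"
      by (rule has_derivative_transform_within_open[OF D(1) open_ball z]) (simp add: eq)
    with D(2) show "\<exists>D. (inv_into (ball 0 1) f has_derivative D) (at z) \<and> (\<forall>c v. D (c *s v) = c *s D v)"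
      by blast
  qed
  with bij hol show ?thesis by (simp add: ball_automorphism_def)
qed

text \<open>
  The Moebius map is built from \<open>l\<close>, \<open>z\<close> and inner products only, so it commutes with every unitary
  map that fixes \<open>l\<close>.
\<close>

lemma moebius_coord_shift:
  assumes \<tau>: "\<tau> permutes UNIV" and l: "coord_shift \<tau> l = l"
  shows "moebius l (coord_shift \<tau> z) = coord_shift \<tau> (moebius l z)"
proof -
  have inv: "l $ \<tau> i = l $ i" for i using l by (metis coord_shift_def vec_lambda_beta)
  have "cdot (coord_shift \<tau> z) l = (\<Sum>j\<in>UNIV. z $ \<tau> j * cnj (l $ \<tau> j))"
    by (simp add: cdot_def coord_shift_def inv)
  also have "\<dots> = cdot z l"
    unfolding cdot_def by (rule sum.permute[OF \<tau>, unfolded o_def, symmetric])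
  finally show ?thesis
    by (simp add: vec_eq_iff moebius_def coord_shift_def inv)
qed


section \<open>Moebius transforms of row isometries\<close>

text \<open>
  The numerator of the \<open>i\<close>-th coordinate of the Moebius map with the operators \<open>V\<^sub>j\<close> in place of the
  coordinates \<open>z\<^sub>j\<close>.
\<close>

definition moebius_numer ::
    "complex ^ 'n::finite \<Rightarrow> ('n \<Rightarrow> 'a ell2 \<Rightarrow>\<^sub>L 'a ell2) \<Rightarrow> 'n \<Rightarrow> 'a ell2 \<Rightarrow>\<^sub>L 'a ell2"
  where "moebius_numer l V i =
    l $ i *\<^sub>o (id_blinfun - (1 / (1 + defect l)) *\<^sub>o row_comb l V) - defect l *\<^sub>o V i"

lemma moebius_numer_in:
  assumes "unital_op_algebra A" "\<And>j. V j \<in> A"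
  shows "moebius_numer l V i \<in> A"
  unfolding moebius_numer_def
  by (intro unital_diff unital_scale unital_id row_comb_in assms)

lemma contractive_hom_moebius_numer:
  assumes "unital_op_algebra A" "contractive_hom A \<Psi>" "\<And>j. V j \<in> A"
  shows "\<Psi> (moebius_numer l V i) = moebius_numer l (\<lambda>j. \<Psi> (V j)) i"
  unfolding moebius_numer_def
  by (simp add: contractive_hom_diff[OF assms(1,2)] contractive_homD(1,6)[OF assms(2)]
      contractive_hom_row_comb[OF assms] unital_diff unital_scale unital_id row_comb_in assms)

text \<open>
  Let \<open>A = \<Sum>\<^sub>j cnj (l\<^sub>j) L\<^sub>j\<close> and \<open>R = (1 - A)\<inverse>\<close>. The operators \<open>L\<^sub>i\<close> do not commute, and it matters that the
  resolvent is put to the left of the numerator: the row \<open>V\<^sub>i = R N\<^sub>i\<close> is again a row isometry, whereas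
  \<open>N\<^sub>i R\<close> is not when there are several letters and \<open>l \<noteq> 0\<close>. The computations use
  \<open>V\<^sub>i = l\<^sub>i - s R M\<^sub>i\<close> with \<open>M\<^sub>i = L\<^sub>i - l\<^sub>i A / (1 + s)\<close>, that is \<open>M = L D\<close> for the positive square root \<open>D\<close> of the
  matrix \<open>1 - l\<^sup>* l\<close>, where \<open>l\<close> is read as a row.
\<close>

context
  fixes l :: "complex ^ 'n::finite" and L :: "'n \<Rightarrow> 'a ell2 \<Rightarrow>\<^sub>L 'a ell2" and r :: "'a ell2 \<Rightarrow>\<^sub>L 'a ell2"
  assumes l: "norm l < 1" and L: "row_isometry L"
    and r_left: "r o\<^sub>L (id_blinfun - row_comb l L) = id_blinfun"
    and r_right: "(id_blinfun - row_comb l L) o\<^sub>L r = id_blinfun"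
begin

private definition "A = blinfun_apply (row_comb l L)"
private definition "R = blinfun_apply r"
private definition "s = sqrt (1 - (norm l)\<^sup>2)"
private definition "M i x = blinfun_apply (L i) x - (1 / (1 + s)) *\<^sub>R A (scaleC_ell2 (l $ i) x)" for i x

private lemma s: "s > 0" "(norm l)\<^sup>2 = 1 - s\<^sup>2" "defect l = complex_of_real s"
proof -
  have pos: "0 < 1 - (norm l)\<^sup>2" using l by (simp add: abs_square_less_1)
  then show "s > 0" "(norm l)\<^sup>2 = 1 - s\<^sup>2" by (simp_all add: s_def)
qed (simp add: defect_def s_def)

private lemma t: "1 / (1 + s) * (1 - s\<^sup>2) = 1 - s"
  using s(1) by (simp add: field_simps power2_eq_square)

private lemma lin:
  "A (x + y) = A x + A y" "A (x - y) = A x - A y" "A (c *\<^sub>R x) = c *\<^sub>R A x"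
  "R (x + y) = R x + R y" "R (x - y) = R x - R y" "R (c *\<^sub>R x) = c *\<^sub>R R x"
  "R (sum f F) = (\<Sum>i\<in>F. R (f i))"
  by (simp_all add: A_def R_def blinfun.bilinear_simps blinfun.sum_right)

private lemma A_scaleC: "A (scaleC_ell2 c x) = scaleC_ell2 c (A x)"
  by (simp add: A_def row_comb_apply complex_linear_opD[OF row_isometryD(1)[OF L]] scaleC_sum_right
      mult.commute)

private lemma R_diff: "R x - A (R x) = x"
  using arg_cong[OF r_right, of "\<lambda>a. blinfun_apply a x"]
  by (simp add: A_def R_def blinfun.diff_left)

private lemma R_eq: "R x = x + A (R x)"
  by (metis R_diff diff_add_cancel)

private lemma R_A: "R (A x) = R x - x"
  using arg_cong[OF r_left, of "\<lambda>a. blinfun_apply a x"]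
  by (simp add: A_def R_def blinfun.diff_left blinfun.diff_right algebra_simps)

private lemma R_scaleC: "R (scaleC_ell2 c x) = scaleC_ell2 c (R x)"
proof -
  have x: "x = R x - A (R x)" by (rule R_diff[symmetric])
  have "R (scaleC_ell2 c x) = R (scaleC_ell2 c (R x) - A (scaleC_ell2 c (R x)))"
    by (subst x) (simp add: scaleC_diff_right A_scaleC)
  also have "\<dots> = scaleC_ell2 c (R x)" by (simp add: lin R_A)
  finally show ?thesis .
qed

private lemma L_A: "blinfun_apply (L i) x \<bullet> A y = scaleC_ell2 (l $ i) x \<bullet> y"
  unfolding A_def by (rule inner_row_comb[OF L])

private lemma A_L: "A y \<bullet> blinfun_apply (L i) x = y \<bullet> scaleC_ell2 (l $ i) x"
  by (metis L_A inner_commute)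

private lemma A_A: "A x \<bullet> A y = (1 - s\<^sup>2) * (x \<bullet> y)"
  unfolding A_def s(2)[symmetric] by (rule row_comb_inner_row_comb[OF L])

text \<open>
  In terms of adjoints, \<open>s\<^sup>2 R\<^sup>* R = R + R\<^sup>* - 1\<close>; it is \<open>A\<^sup>* A = 1 - s\<^sup>2\<close> multiplied by \<open>R\<close> and \<open>R\<^sup>*\<close>. It lets the
  quadratic term of \<open>V\<^sub>i\<^sup>* V\<^sub>j\<close> be replaced by terms linear in \<open>R\<close>.
\<close>

private lemma R_R: "s\<^sup>2 * (R g \<bullet> R h) = R g \<bullet> h + g \<bullet> R h - g \<bullet> h"
proof -
  have "A (R g) = R g - g" "A (R h) = R h - h"
    by (metis R_eq add_diff_cancel_left')+
  then have "A (R g) \<bullet> A (R h) = (R g - g) \<bullet> (R h - h)" by simp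
  then show ?thesis
    unfolding A_A by (simp add: inner_diff_left inner_diff_right algebra_simps)
qed

private lemma M_A: "M i x \<bullet> A v = s * (scaleC_ell2 (l $ i) x \<bullet> v)"
proof -
  have "M i x \<bullet> A v = (1 - 1 / (1 + s) * (1 - s\<^sup>2)) * (scaleC_ell2 (l $ i) x \<bullet> v)"
    by (simp add: M_def inner_diff_left L_A A_A algebra_simps)
  then show ?thesis by (simp only: t) simp
qed

private lemma A_M: "A v \<bullet> M i x = s * (v \<bullet> scaleC_ell2 (l $ i) x)"
  by (metis M_A inner_commute)

text \<open>
  Since \<open>M = L D\<close> and \<open>L\<^sub>i\<^sup>* L\<^sub>j = \<delta>\<^sub>i\<^sub>j\<close>, the product \<open>M\<^sub>i\<^sup>* M\<^sub>j\<close> is an entry of \<open>D\<^sup>2 = 1 - l\<^sup>* l\<close>.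
\<close>

private lemma M_M:
  "M i x \<bullet> M j y = (if i = j then x \<bullet> y else 0) - scaleC_ell2 (l $ i) x \<bullet> scaleC_ell2 (l $ j) y"
proof -
  have "M i x \<bullet> M j y = M i x \<bullet> blinfun_apply (L j) y
      - 1 / (1 + s) * (M i x \<bullet> A (scaleC_ell2 (l $ j) y))"
    by (simp add: M_def[of j] inner_diff_right)
  also have "M i x \<bullet> blinfun_apply (L j) y = (if i = j then x \<bullet> y else 0)
      - 1 / (1 + s) * (scaleC_ell2 (l $ i) x \<bullet> scaleC_ell2 (l $ j) y)"
    by (simp add: M_def inner_diff_left row_isometryD(2)[OF L] A_L)
  finally have "M i x \<bullet> M j y = (if i = j then x \<bullet> y else 0)
      - 1 / (1 + s) * (scaleC_ell2 (l $ i) x \<bullet> scaleC_ell2 (l $ j) y)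
      - 1 / (1 + s) * (s * (scaleC_ell2 (l $ i) x \<bullet> scaleC_ell2 (l $ j) y))"
    unfolding M_A .
  moreover have "1 / (1 + s) * q + 1 / (1 + s) * (s * q) = q" for q
  proof -
    have "1 / (1 + s) * (1 + s) = 1" using s(1) by simp
    then show ?thesis by algebra
  qed
  ultimately show ?thesis by (metis diff_diff_eq)
qed

private lemma moebius_row_apply:
  "blinfun_apply (r o\<^sub>L moebius_numer l L i) x = scaleC_ell2 (l $ i) x - s *\<^sub>R R (M i x)"
proof -
  have "1 - s / (1 + s) = 1 / (1 + s)" using s(1) by (simp add: field_simps)
  then have c: "complex_of_real (1 / (1 + s)) = 1 - complex_of_real (s / (1 + s))"
    by (metis of_real_1 of_real_diff)
  have "blinfun_apply (moebius_numer l L i) x =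
      (scaleC_ell2 (l $ i) x - A (scaleC_ell2 (l $ i) x)) - s *\<^sub>R M i x"
  proof -
    have "blinfun_apply (moebius_numer l L i) x = scaleC_ell2 (l $ i) x
       - scaleC_ell2 (l $ i) (scaleC_ell2 (complex_of_real (1 / (1 + s))) (A x)) - s *\<^sub>R blinfun_apply (L i) x"
      by (simp add: moebius_numer_def blinfun.diff_left A_def s(3) scaleC_diff_right scaleC_of_real)
    also have "\<dots> = (scaleC_ell2 (l $ i) x - A (scaleC_ell2 (l $ i) x)) - s *\<^sub>R M i x"
      unfolding c M_def A_scaleC
      by (rule ell2_eqI) (simp add: ell2_coeff_simps algebra_simps)
    finally show ?thesis .
  qed
  then have "blinfun_apply (r o\<^sub>L moebius_numer l L i) x =
      R ((scaleC_ell2 (l $ i) x - A (scaleC_ell2 (l $ i) x)) - s *\<^sub>R M i x)"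
    by (simp add: R_def)
  also have "\<dots> = scaleC_ell2 (l $ i) x - s *\<^sub>R R (M i x)"
    by (simp add: lin R_A)
  finally show ?thesis .
qed

private lemma M_scaleC: "M i (scaleC_ell2 c x) = scaleC_ell2 c (M i x)"
  unfolding M_def complex_linear_opD[OF row_isometryD(1)[OF L]] A_scaleC
  by (rule ell2_eqI) (simp add: ell2_coeff_simps algebra_simps)

lemma row_isometry_moebius: "row_isometry (\<lambda>i. r o\<^sub>L moebius_numer l L i)"
  unfolding row_isometry_def
proof (intro conjI allI)
  fix i
  show "complex_linear_op (r o\<^sub>L moebius_numer l L i)"
    unfolding complex_linear_op_def moebius_row_apply M_scaleC R_scaleC
    by (intro allI ell2_eqI) (simp add: ell2_coeff_simps algebra_simps)
next
  fix i j and x y :: "'a ell2"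
  let ?x = "scaleC_ell2 (l $ i) x" and ?y = "scaleC_ell2 (l $ j) y"
  have "M i x \<bullet> R (M j y) = M i x \<bullet> M j y + s * (?x \<bullet> R (M j y))"
    by (subst R_eq) (simp add: inner_add_right M_A)
  moreover have "R (M i x) \<bullet> M j y = M i x \<bullet> M j y + s * (R (M i x) \<bullet> ?y)"
    by (subst R_eq) (simp add: inner_add_left A_M)
  ultimately have "s\<^sup>2 * (R (M i x) \<bullet> R (M j y)) = M i x \<bullet> M j y
      + s * (?x \<bullet> R (M j y)) + s * (R (M i x) \<bullet> ?y)"
    unfolding R_R by simp
  then show "blinfun_apply (r o\<^sub>L moebius_numer l L i) x \<bullet> blinfun_apply (r o\<^sub>L moebius_numer l L j) y =
      (if i = j then x \<bullet> y else 0)"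
    unfolding moebius_row_apply M_M
    by (auto simp: inner_diff_left inner_diff_right power2_eq_square algebra_simps)
qed

text \<open>
  For a wandering vector \<open>\<xi>\<close> of \<open>L\<close>, the vector \<open>R \<xi>\<close> is a joint eigenvector of the adjoints \<open>L\<^sub>j\<^sup>*\<close> with
  eigenvalues \<open>cnj (l\<^sub>j)\<close>; for the creation operators it is the kernel function at the point \<open>l\<close>. The Moebius
  map vanishes at \<open>l\<close>, so the adjoints of the \<open>V\<^sub>j\<close> annihilate \<open>R \<xi>\<close>. Normalisation costs the factor \<open>s\<close>.
\<close>

lemma moebius_wandering:
  assumes \<xi>: "norm \<xi> = 1" "\<And>j y. \<xi> \<bullet> blinfun_apply (L j) y = 0"
  shows "norm (sqrt (1 - (norm l)\<^sup>2) *\<^sub>R blinfun_apply r \<xi>) = 1"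
    and "(sqrt (1 - (norm l)\<^sup>2) *\<^sub>R blinfun_apply r \<xi>) \<bullet> blinfun_apply (r o\<^sub>L moebius_numer l L j) y = 0"
proof -
  have \<xi>_A: "\<xi> \<bullet> A x = 0" for x
    by (simp add: A_def row_comb_apply inner_sum_right \<xi>(2)
        complex_linear_opD[OF row_isometryD(1)[OF L], symmetric])
  have \<xi>_R: "\<xi> \<bullet> R x = \<xi> \<bullet> x" for x
    by (subst R_eq) (simp add: inner_add_right \<xi>_A)
  have R_\<xi>: "R x \<bullet> \<xi> = x \<bullet> \<xi>" for x
    by (metis inner_commute \<xi>_R)
  have "(norm (s *\<^sub>R R \<xi>))\<^sup>2 = s\<^sup>2 * (R \<xi> \<bullet> R \<xi>)"
    by (simp add: power_mult_distrib power2_norm_eq_inner)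
  also have "\<dots> = \<xi> \<bullet> \<xi>"
    unfolding R_R by (simp add: \<xi>_R R_\<xi>)
  finally have "(norm (s *\<^sub>R R \<xi>))\<^sup>2 = 1" by (simp add: \<xi>(1) power2_norm_eq_inner[symmetric])
  then show "norm (sqrt (1 - (norm l)\<^sup>2) *\<^sub>R blinfun_apply r \<xi>) = 1"
    unfolding s_def[symmetric] R_def[symmetric]
    using power2_eq_iff_nonneg[of "norm (s *\<^sub>R R \<xi>)" 1] by simp
  have \<xi>_M: "\<xi> \<bullet> M j y = 0"
    by (simp add: M_def inner_diff_right \<xi>(2) \<xi>_A)
  have "R \<xi> \<bullet> M j y = s * (R \<xi> \<bullet> scaleC_ell2 (l $ j) y)"
    by (subst R_eq) (simp add: inner_add_left \<xi>_M A_M)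
  then have "s\<^sup>2 * (R \<xi> \<bullet> R (M j y)) = s * (R \<xi> \<bullet> scaleC_ell2 (l $ j) y)"
    unfolding R_R by (simp add: \<xi>_R \<xi>_M)
  then show "(sqrt (1 - (norm l)\<^sup>2) *\<^sub>R blinfun_apply r \<xi>) \<bullet> blinfun_apply (r o\<^sub>L moebius_numer l L j) y = 0"
    unfolding s_def[symmetric] R_def[symmetric] moebius_row_apply
    by (auto simp: inner_diff_right power2_eq_square algebra_simps)
qed

text \<open>
  The operator form of the involution property: with the \<open>V\<^sub>j\<close> in place of the \<open>L\<^sub>j\<close>, the Moebius
  formula returns the \<open>L\<^sub>i\<close>. The key is \<open>\<Sum>\<^sub>j cnj (l\<^sub>j) V\<^sub>j = 1 - s\<^sup>2 R\<close>, as for the scalar map. The denominator is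
  kept on the left-hand side: that its inverse lies in the algebra generated by the \<open>V\<^sub>j\<close> is a separate
  matter, settled by the Neumann series.
\<close>

lemma moebius_row_inverse:
  defines "V \<equiv> \<lambda>i. r o\<^sub>L moebius_numer l L i"
  shows "(id_blinfun - row_comb l V) o\<^sub>L L i = moebius_numer l V i"
proof -
  have V: "blinfun_apply (V j) x = scaleC_ell2 (l $ j) x - s *\<^sub>R R (M j x)" for j x
    unfolding V_def by (rule moebius_row_apply)
  have ll: "(\<Sum>j\<in>UNIV. cnj (l $ j) * l $ j) = complex_of_real (1 - s\<^sup>2)"
    using cdot_self[of l] by (simp add: cdot_def s(2) mult.commute)
  have comb: "(\<Sum>j\<in>UNIV. scaleC_ell2 (cnj (l $ j)) (scaleC_ell2 (l $ j) x)) = (1 - s\<^sup>2) *\<^sub>R x" for x :: "'a ell2"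
    by (rule ell2_eqI) (simp add: ell2_coeff_simps sum_distrib_right[symmetric] ll)
  have sum_M: "(\<Sum>j\<in>UNIV. scaleC_ell2 (cnj (l $ j)) (M j x)) = s *\<^sub>R A x" for x
  proof -
    have "scaleC_ell2 (cnj (l $ j)) (M j x) = scaleC_ell2 (cnj (l $ j)) (blinfun_apply (L j) x)
       - (1 / (1 + s)) *\<^sub>R scaleC_ell2 (cnj (l $ j)) (scaleC_ell2 (l $ j) (A x))" for j
      unfolding M_def A_scaleC by (rule ell2_eqI) (simp add: ell2_coeff_simps algebra_simps)
    then have "(\<Sum>j\<in>UNIV. scaleC_ell2 (cnj (l $ j)) (M j x)) = A x - (1 / (1 + s)) *\<^sub>R (1 - s\<^sup>2) *\<^sub>R A x"
      by (simp only: sum_subtractf scaleR_right.sum[symmetric] comb) (simp add: A_def row_comb_apply)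
    also have "\<dots> = (1 - 1 / (1 + s) * (1 - s\<^sup>2)) *\<^sub>R A x"
      by (simp only: scaleR_left_diff_distrib[of 1 "1 / (1 + s) * (1 - s\<^sup>2)"] scaleR_scaleR scaleR_one)
    finally show ?thesis by (simp only: t) simp
  qed
  have AV: "blinfun_apply (row_comb l V) x = x - s\<^sup>2 *\<^sub>R R x" for x
  proof -
    have "blinfun_apply (row_comb l V) x =
       (\<Sum>j\<in>UNIV. scaleC_ell2 (cnj (l $ j)) (scaleC_ell2 (l $ j) x)
          - s *\<^sub>R R (scaleC_ell2 (cnj (l $ j)) (M j x)))"
      unfolding row_comb_apply V R_scaleC
      by (intro sum.cong refl ell2_eqI) (simp add: ell2_coeff_simps algebra_simps)
    also have "\<dots> = (1 - s\<^sup>2) *\<^sub>R x - s *\<^sub>R R (\<Sum>j\<in>UNIV. scaleC_ell2 (cnj (l $ j)) (M j x))"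
      by (simp only: sum_subtractf scaleR_right.sum[symmetric] comb lin)
    also have "\<dots> = x - s\<^sup>2 *\<^sub>R R x"
      by (simp add: sum_M lin R_A scaleR_left_diff_distrib scaleR_diff_right power2_eq_square)
    finally show ?thesis .
  qed
  show ?thesis
  proof (rule blinfun_eqI)
    fix x
    have "1 - s - 1 / (1 + s) * (1 - s\<^sup>2) = 0" by (simp only: t)
    then have c: "complex_of_real (1 - s - 1 / (1 + s) * (1 - s\<^sup>2)) = 0" by simp
    have RL: "R (M i x) = R (blinfun_apply (L i) x) - (1 / (1 + s)) *\<^sub>R scaleC_ell2 (l $ i) (R x - x)"
      by (simp add: M_def lin A_scaleC R_scaleC R_A)
    have "blinfun_apply (moebius_numer l V i) x =
        scaleC_ell2 (l $ i) (x - (1 / (1 + s)) *\<^sub>R (x - s\<^sup>2 *\<^sub>R R x))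
          - s *\<^sub>R (scaleC_ell2 (l $ i) x - s *\<^sub>R R (M i x))"
      using scaleC_of_real[of "1 / (1 + s)" "x - s\<^sup>2 *\<^sub>R R x"]
      by (simp add: moebius_numer_def blinfun.diff_left s(3) scaleC_of_real AV V)
    also have "\<dots> = s\<^sup>2 *\<^sub>R R (blinfun_apply (L i) x)
        + scaleC_ell2 (l $ i * complex_of_real (1 - s - 1 / (1 + s) * (1 - s\<^sup>2))) x"
      unfolding RL by (rule ell2_eqI) (simp add: ell2_coeff_simps power2_eq_square algebra_simps)
    also have "\<dots> = s\<^sup>2 *\<^sub>R R (blinfun_apply (L i) x)"
      unfolding c by (rule ell2_eqI) (simp add: ell2_coeff_simps)
    also have "\<dots> = blinfun_apply ((id_blinfun - row_comb l V) o\<^sub>L L i) x"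
      by (simp add: blinfun.diff_left AV)
    finally show "blinfun_apply ((id_blinfun - row_comb l V) o\<^sub>L L i) x = blinfun_apply (moebius_numer l V i) x" ..
  qed
qed

end

text \<open>
  Solving the inverse relation for \<open>L\<^sub>i\<close> shows that the row \<open>V\<close> generates the whole algebra, so the
  homomorphism with \<open>V\<^sub>i \<mapsto> L\<^sub>i\<close> is defined on all of it. Applying it to the inverse relation gives
  \<open>L\<^sub>i \<mapsto> V\<^sub>i\<close>. It is therefore its own inverse.
\<close>

lemma moebius_hom:
  fixes l :: "complex ^ 'n::finite"
  assumes l: "norm l < 1"
  obtains \<Psi> where "contractive_hom nc_disc_algebra \<Psi>"
    "\<And>i. (id_blinfun - row_comb l creation) o\<^sub>L \<Psi> (creation i) = moebius_numer l creation i"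
    "\<And>a. a \<in> nc_disc_algebra \<Longrightarrow> \<Psi> (\<Psi> a) = a"
proof -
  obtain r :: "'n list ell2 \<Rightarrow>\<^sub>L 'n list ell2" where r: "r \<in> nc_disc_algebra"
    "r o\<^sub>L (id_blinfun - row_comb l creation) = id_blinfun"
    "(id_blinfun - row_comb l creation) o\<^sub>L r = id_blinfun"
    by (rule row_comb_resolvent[OF unital_nc closed_nc row_isometry_creation creation_in_nc l])
  define V where "V i = r o\<^sub>L moebius_numer l creation i" for i
  note V_eq = V_def[abs_def, symmetric]
  have V: "row_isometry V"
    using row_isometry_moebius[OF l row_isometry_creation r(2,3)] unfolding V_eq .
  have V_in: "V i \<in> nc_disc_algebra" for i
    unfolding V_def by (intro unital_comp moebius_numer_in unital_nc r(1) creation_in_nc)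
  let ?\<eta> = "sqrt (1 - (norm l)\<^sup>2) *\<^sub>R blinfun_apply r (basis_ell2 [])"
  have \<eta>: "norm ?\<eta> = 1" "?\<eta> \<bullet> blinfun_apply (V j) y = 0" for j y
    using moebius_wandering[OF l row_isometry_creation r(2,3) norm_basis_ell2 inner_vacuum_creation]
    unfolding V_def by blast+
  have inverse: "(id_blinfun - row_comb l V) o\<^sub>L creation i = moebius_numer l V i" for i
    using moebius_row_inverse[OF l row_isometry_creation r(2,3)] unfolding V_eq .
  let ?B = "closed_algebra_generated (range V)"
  note uB = unital_op_algebra_generated[of "range V"] and cB = closed_closed_algebra_generated[of "range V"]
  have VB: "V i \<in> ?B" for i by (rule subsetD[OF generators_in_generated rangeI])
  obtain r' where r': "r' \<in> ?B" "r' o\<^sub>L (id_blinfun - row_comb l V) = id_blinfun"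
    "(id_blinfun - row_comb l V) o\<^sub>L r' = id_blinfun"
    by (rule row_comb_resolvent[OF uB cB V VB l])
  have "creation i = r' o\<^sub>L moebius_numer l V i" for i
    unfolding inverse[symmetric] blinfun_comp_assoc[symmetric] r'(2) by simp
  then have "range creation \<subseteq> ?B"
    using unital_comp[OF uB r'(1) moebius_numer_in[of ?B V, OF uB VB]] by auto
  then have gen: "nc_disc_algebra \<subseteq> ?B"
    unfolding nc_disc_algebra_def by (rule generated_least[OF uB cB])
  obtain \<Psi> where \<Psi>: "contractive_hom nc_disc_algebra \<Psi>" "\<And>i. \<Psi> (V i) = creation i"
    by (rule contractive_hom_of_wandering_vector[OF V \<eta> gen V_in]) (rule that)
  have eq: "(id_blinfun - row_comb l creation) o\<^sub>L \<Psi> (creation i) = moebius_numer l creation i" for i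
  proof -
    have "\<Psi> ((id_blinfun - row_comb l V) o\<^sub>L creation i) = \<Psi> (moebius_numer l V i)"
      by (simp only: inverse)
    then show ?thesis
      by (simp add: contractive_homD(1,5)[OF \<Psi>(1)] contractive_hom_diff[OF unital_nc \<Psi>(1)]
          contractive_hom_row_comb[OF unital_nc \<Psi>(1)] contractive_hom_moebius_numer[OF unital_nc \<Psi>(1)]
          unital_diff[OF unital_nc] unital_id[OF unital_nc] row_comb_in[OF unital_nc] creation_in_nc V_in \<Psi>(2))
  qed
  have \<Psi>_creation: "\<Psi> (creation i) = V i" for i
  proof -
    have "\<Psi> (creation i) = r o\<^sub>L ((id_blinfun - row_comb l creation) o\<^sub>L \<Psi> (creation i))"
      by (simp add: blinfun_comp_assoc[symmetric] r(2))
    then show ?thesis by (simp add: eq V_def)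
  qed
  have "\<Psi> (\<Psi> a) = a" if "a \<in> nc_disc_algebra" for a
    by (rule nc_hom_eqI[OF contractive_hom_comp[OF \<Psi>(1) \<Psi>(1)] contractive_hom_id _ that])
       (auto simp: \<Psi>_creation \<Psi>(2))
  with \<Psi>(1) eq show thesis by (rule that)
qed


section \<open>Characters of the noncommutative disc algebra\<close>

lemma characterD:
  assumes "\<phi> \<in> characters A"
  shows "\<phi> \<in> extensional A" "\<phi> id_blinfun = 1"
    and "a \<in> A \<Longrightarrow> b \<in> A \<Longrightarrow> \<phi> (a + b) = \<phi> a + \<phi> b"
    and "a \<in> A \<Longrightarrow> b \<in> A \<Longrightarrow> \<phi> (a o\<^sub>L b) = \<phi> a * \<phi> b"
    and "a \<in> A \<Longrightarrow> \<phi> (c *\<^sub>o a) = c * \<phi> a"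
  using assms by (auto simp: characters_def)

lemma character_diff:
  assumes "unital_op_algebra A" "\<phi> \<in> characters A" "a \<in> A" "b \<in> A"
  shows "\<phi> (a - b) = \<phi> a - \<phi> b"
  using characterD(3)[OF assms(2) unital_diff[OF assms(1,3,4)] assms(4)] by (simp add: algebra_simps)

lemma character_sum:
  assumes "unital_op_algebra A" "\<phi> \<in> characters A" "\<And>i. i \<in> F \<Longrightarrow> f i \<in> A"
  shows "\<phi> (sum f F) = (\<Sum>i\<in>F. \<phi> (f i))"
proof -
  have "\<phi> 0 = 0"
    using character_diff[OF assms(1,2) unital_id[OF assms(1)] unital_id[OF assms(1)]] by simp
  then show ?thesis
    using assms(3)
    by (induction F rule: infinite_finite_induct)
       (auto simp: characterD(3)[OF assms(2)] unital_sum[OF assms(1)])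
qed

lemma character_row_comb:
  assumes "unital_op_algebra A" "\<phi> \<in> characters A" "\<And>j. V j \<in> A"
  shows "\<phi> (row_comb l V) = cdot (\<chi> j. \<phi> (V j)) l"
  unfolding row_comb_def cdot_def
  by (simp add: character_sum[OF assms(1,2)] unital_scale[OF assms(1)] assms(3)
      characterD(5)[OF assms(2)] mult.commute)

text \<open>
  Characters of a closed algebra are contractive: if \<open>\<phi>\<close> were \<open>1\<close> at some \<open>b\<close> with \<open>\<parallel>b\<parallel> < 1\<close>, it would
  annihilate the invertible element \<open>1 - b\<close>.
\<close>

lemma norm_character_le:
  assumes A: "unital_op_algebra A" "closed A" and \<phi>: "\<phi> \<in> characters A" and a: "a \<in> A"
  shows "cmod (\<phi> a) \<le> norm a"
proof (rule ccontr)
  assume "\<not> cmod (\<phi> a) \<le> norm a"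
  then have less: "norm a < cmod (\<phi> a)" by simp
  then have nz: "\<phi> a \<noteq> 0" by (metis norm_not_less_zero norm_zero)
  define b where "b = (1 / \<phi> a) *\<^sub>o a"
  have b: "b \<in> A" unfolding b_def by (rule unital_scale[OF A(1) a])
  have "norm b \<le> norm a / cmod (\<phi> a)"
    unfolding b_def
  proof (rule norm_blinfun_bound)
    fix x
    have "norm (blinfun_apply ((1 / \<phi> a) *\<^sub>o a) x) = norm (blinfun_apply a x) / cmod (\<phi> a)"
      by (simp add: norm_scaleC_ell2 norm_divide)
    also have "\<dots> \<le> norm a * norm x / cmod (\<phi> a)"
      by (intro divide_right_mono norm_blinfun) simp
    finally show "norm (blinfun_apply ((1 / \<phi> a) *\<^sub>o a) x) \<le> norm a / cmod (\<phi> a) * norm x" by simp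
  qed simp
  also have "\<dots> < 1" using less nz by simp
  finally have "norm b < 1" .
  then obtain r where r: "r \<in> A" "r o\<^sub>L (id_blinfun - b) = id_blinfun" "(id_blinfun - b) o\<^sub>L r = id_blinfun"
    by (rule neumann_inverse[OF A b])
  have "\<phi> (r o\<^sub>L (id_blinfun - b)) = \<phi> r * (1 - \<phi> b)"
    by (simp add: characterD(2,4)[OF \<phi>] r(1) b character_diff[OF A(1) \<phi>] unital_diff[OF A(1)] unital_id[OF A(1)])
  moreover have "\<phi> b = 1" using nz by (simp add: b_def characterD(5)[OF \<phi> a])
  ultimately show False by (simp add: r(2) characterD(2)[OF \<phi>])
qed

lemma character_eqI:
  assumes A: "A = closed_algebra_generated S"
    and \<phi>: "\<phi> \<in> characters A" and \<psi>: "\<psi> \<in> characters A"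
    and eq: "\<And>a. a \<in> S \<Longrightarrow> \<phi> a = \<psi> a"
  shows "\<phi> = \<psi>"
proof -
  have uA: "unital_op_algebra A" and cA: "closed A"
    unfolding A by (rule unital_op_algebra_generated closed_closed_algebra_generated)+
  have cont: "continuous_on A \<phi>" if "\<phi> \<in> characters A" for \<phi>
  proof (rule lipschitz_on_continuous_on)
    show "1-lipschitz_on A \<phi>"
    proof (rule lipschitz_onI)
      fix a b assume "a \<in> A" "b \<in> A"
      then show "dist (\<phi> a) (\<phi> b) \<le> 1 * dist a b"
        using norm_character_le[OF uA cA that unital_diff[OF uA], of a b]
        by (simp add: dist_norm character_diff[OF uA that])
    qed simp
  qed
  have "closed {a \<in> A. \<phi> a - \<psi> a = 0}"
    by (intro continuous_closed_preimage_constant continuous_on_diff cont cA \<phi> \<psi>)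
  then have "closed {a \<in> A. \<phi> a = \<psi> a}" by simp
  moreover have "unital_op_algebra {a \<in> A. \<phi> a = \<psi> a}"
    unfolding unital_op_algebra_def
    by (auto simp: unital_op_algebraD[OF uA] characterD(2-5)[OF \<phi>] characterD(2-5)[OF \<psi>])
  moreover have "S \<subseteq> {a \<in> A. \<phi> a = \<psi> a}"
    using eq generators_in_generated A by blast
  ultimately have "A \<subseteq> {a \<in> A. \<phi> a = \<psi> a}"
    using generated_least A by metis
  then show ?thesis
    by (intro extensionalityI[OF characterD(1)[OF \<phi>] characterD(1)[OF \<psi>]]) auto
qed

lemma bounded_linear_scaleC_left: "bounded_linear (\<lambda>c. scaleC_ell2 c x)"
proof (rule bounded_linear_intro)
  show "scaleC_ell2 (c + d) x = scaleC_ell2 c x + scaleC_ell2 d x" for c d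
    by (rule ell2_eqI) (simp add: ell2_coeff_simps algebra_simps)
  show "scaleC_ell2 (k *\<^sub>R c) x = k *\<^sub>R scaleC_ell2 c x" for k c
    by (rule ell2_eqI) (simp add: ell2_coeff_simps scaleR_conv_of_real)
  show "norm (scaleC_ell2 c x) \<le> norm c * norm x" for c
    by (simp add: norm_scaleC_ell2)
qed

text \<open>
  If \<open>\<nu>\<close> is a joint eigenvector of the adjoints of the generators, then \<open>a\<^sup>* \<nu> = cnj (\<phi>(a)) \<nu>\<close> defines a
  character \<open>\<phi>\<close>. In terms of the real inner product the eigenvector equation reads
  \<open>\<nu> \<bullet> k a x = \<nu> \<bullet> k \<phi>(a) x\<close> for all \<open>x\<close> and all scalars \<open>k\<close>; the scalar makes the condition stable under products
  for operators that are only real linear.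
\<close>

lemma character_of_eigenvector:
  fixes \<nu> :: "'a ell2"
  assumes \<nu>: "\<nu> \<noteq> 0" and A: "A = closed_algebra_generated (range V)"
    and eigen: "\<And>i k x. \<nu> \<bullet> scaleC_ell2 k (blinfun_apply (V i) x) = \<nu> \<bullet> scaleC_ell2 (k * m i) x"
  obtains \<phi> where "\<phi> \<in> characters A" "\<And>i. \<phi> (V i) = m i"
proof -
  define E where "E a c \<longleftrightarrow>
    (\<forall>k x. \<nu> \<bullet> scaleC_ell2 k (blinfun_apply a x) = \<nu> \<bullet> scaleC_ell2 (k * c) x)" for a c
  (* the only candidate, given by an explicit formula to make its continuity visible *)
  define \<phi> where "\<phi> a = (complex_of_real (\<nu> \<bullet> blinfun_apply a \<nu>)
      + \<i> * complex_of_real (\<nu> \<bullet> scaleC_ell2 (- \<i>) (blinfun_apply a \<nu>))) / complex_of_real ((norm \<nu>)\<^sup>2)" for a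
  have E_unique: "\<phi> a = c" if "E a c" for a c
  proof -
    have v: "\<nu> \<bullet> scaleC_ell2 d \<nu> = Re d * (norm \<nu>)\<^sup>2" for d
      using inner_scaleC_self[of 1 \<nu> d] by (simp add: inner_complex_def)
    have "\<nu> \<bullet> scaleC_ell2 1 (blinfun_apply a \<nu>) = \<nu> \<bullet> scaleC_ell2 (1 * c) \<nu>"
      "\<nu> \<bullet> scaleC_ell2 (- \<i>) (blinfun_apply a \<nu>) = \<nu> \<bullet> scaleC_ell2 (- \<i> * c) \<nu>"
      using that unfolding E_def by blast+
    then have "\<nu> \<bullet> blinfun_apply a \<nu> = Re c * (norm \<nu>)\<^sup>2"
      "\<nu> \<bullet> scaleC_ell2 (- \<i>) (blinfun_apply a \<nu>) = Im c * (norm \<nu>)\<^sup>2"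
      unfolding v by simp_all
    moreover have "complex_of_real ((norm \<nu>)\<^sup>2) \<noteq> 0" using \<nu> by simp
    ultimately show ?thesis
      unfolding \<phi>_def by (simp add: complex_eq_iff field_simps del: of_real_power)
  qed
  have E_id: "E id_blinfun 1" by (simp add: E_def)
  have E_add: "E (a + b) (c + d)" if "E a c" "E b d" for a b c d
  proof -
    have "scaleC_ell2 (k * (c + d)) x = scaleC_ell2 (k * c) x + scaleC_ell2 (k * d) x" for k and x :: "'a ell2"
      by (rule ell2_eqI) (simp add: ell2_coeff_simps algebra_simps)
    then show ?thesis
      using that by (simp add: E_def blinfun.add_left scaleC_add_right inner_add_right)
  qed
  have E_mult: "E (a o\<^sub>L b) (c * d)" if "E a c" "E b d" for a b c d
    using that by (simp add: E_def mult.assoc)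
  have E_scale: "E (c *\<^sub>o a) (c * d)" if "E a d" for a c d
    using that by (simp add: E_def mult.assoc)
  have "unital_op_algebra {a. \<exists>c. E a c}"
    unfolding unital_op_algebra_def using E_id E_add E_mult E_scale by blast
  moreover have "{a. \<exists>c. E a c} = {a. E a (\<phi> a)}"
    using E_unique by blast
  moreover have "closed {a. E a (\<phi> a)}"
    unfolding E_def \<phi>_def
    by (intro closed_Collect_all closed_Collect_eq continuous_intros
        bounded_linear.continuous_on[OF bounded_linear_scaleC]
        bounded_linear.continuous_on[OF bounded_linear_scaleC_left]) (use \<nu> in auto)
  moreover have S: "E (V i) (m i)" for i
    using eigen by (simp add: E_def)
  then have "range V \<subseteq> {a. \<exists>c. E a c}" by blast
  ultimately have "A \<subseteq> {a. E a (\<phi> a)}"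
    unfolding A using generated_least by metis
  then have E: "E a (\<phi> a)" if "a \<in> A" for a using that by blast
  have uA: "unital_op_algebra A" unfolding A by (rule unital_op_algebra_generated)
  have "restrict \<phi> A \<in> characters A"
    unfolding characters_def
    by (auto simp: unital_op_algebraD[OF uA] intro: E_unique E_id E_add E_mult E_scale E)
  moreover have "restrict \<phi> A (V i) = m i" for i
    using E_unique[OF S] subsetD[OF generators_in_generated rangeI, of V i] by (simp add: A)
  ultimately show thesis by (rule that)
qed

lemma point_character_spec:
  fixes \<mu> :: "complex ^ 'n::finite"
  assumes \<mu>: "norm \<mu> < 1"
  shows "point_character \<mu> \<in> characters nc_disc_algebra"
    and "point_character \<mu> (creation i) = \<mu> $ i"
proof -
  obtain r :: "'n list ell2 \<Rightarrow>\<^sub>L 'n list ell2" where r: "r \<in> nc_disc_algebra"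
    "r o\<^sub>L (id_blinfun - row_comb \<mu> creation) = id_blinfun"
    "(id_blinfun - row_comb \<mu> creation) o\<^sub>L r = id_blinfun"
    by (rule row_comb_resolvent[OF unital_nc closed_nc row_isometry_creation creation_in_nc \<mu>])
  (* the eigenvector of the adjoints of the creation operators for the eigenvalues cnj (mu $ i) *)
  define \<nu> where "\<nu> = blinfun_apply r (basis_ell2 [])"
  have \<nu>: "\<nu> = basis_ell2 [] + blinfun_apply (row_comb \<mu> creation) \<nu>"
    using arg_cong[OF r(3), of "\<lambda>a. blinfun_apply a (basis_ell2 [])"]
    by (simp add: \<nu>_def blinfun.diff_left algebra_simps)
  have eig: "\<nu> \<bullet> blinfun_apply (creation i) y = \<nu> \<bullet> scaleC_ell2 (\<mu> $ i) y" for i y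
    by (subst \<nu>) (simp add: inner_add_left inner_vacuum_creation inner_commute[of "blinfun_apply (row_comb _ _) _"]
        inner_row_comb[OF row_isometry_creation], simp add: inner_commute)
  have "\<nu> \<noteq> 0"
  proof
    assume "\<nu> = 0"
    then have "basis_ell2 ([] :: 'n list) = 0" using \<nu> by simp
    then show False using norm_basis_ell2[of "[] :: 'n list"] by simp
  qed
  have "\<nu> \<bullet> scaleC_ell2 k (blinfun_apply (creation i) x) = \<nu> \<bullet> scaleC_ell2 (k * \<mu> $ i) x" for i k x
    unfolding complex_linear_opD[OF row_isometryD(1)[OF row_isometry_creation], symmetric] eig
    by (simp add: mult.commute)
  then obtain \<phi> where \<phi>: "\<phi> \<in> characters nc_disc_algebra" "\<And>i. \<phi> (creation i) = \<mu> $ i"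
    by (rule character_of_eigenvector[OF \<open>\<nu> \<noteq> 0\<close> nc_disc_algebra_def]) (rule that)
  let ?P = "\<lambda>\<phi>. \<phi> \<in> characters nc_disc_algebra \<and> (\<forall>i. \<phi> (creation i) = \<mu> $ i)"
  have "?P (THE \<phi>. ?P \<phi>)"
  proof (rule theI[where P = ?P])
    show "?P \<phi>" using \<phi> by blast
    show "\<psi> = \<phi>" if "?P \<psi>" for \<psi>
      by (rule character_eqI[OF nc_disc_algebra_def]) (use that \<phi> in auto)
  qed
  then have "?P (point_character \<mu>)" unfolding point_character_def .
  then show "point_character \<mu> \<in> characters nc_disc_algebra"
    and "point_character \<mu> (creation i) = \<mu> $ i" by auto
qed

lemma point_character_unique:
  assumes "norm \<mu> < 1" "\<phi> \<in> characters nc_disc_algebra" "\<And>i. \<phi> (creation i) = \<mu> $ i"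
  shows "\<phi> = point_character \<mu>"
  by (rule character_eqI[OF nc_disc_algebra_def assms(2) point_character_spec(1)[OF assms(1)]])
     (auto simp: assms(3) point_character_spec(2)[OF assms(1)])


section \<open>Moebius automorphisms and the coordinate shift\<close>

text \<open>
  A point character is evaluated on \<open>\<Psi>(L\<^sub>i)\<close> by applying it to the equation
  \<open>(1 - A) \<Psi>(L\<^sub>i) = N\<^sub>i\<close>, which turns into the scalar Moebius formula. The two characters to be compared
  then agree on the generators.
\<close>

lemma extends_ball_map_moebius:
  fixes l :: "complex ^ 'n::finite"
  assumes l: "norm l < 1" and \<Psi>: "contractive_hom nc_disc_algebra \<Psi>"
    and inv: "\<And>a. a \<in> nc_disc_algebra \<Longrightarrow> \<Psi> (\<Psi> a) = a"
    and eq: "\<And>i. (id_blinfun - row_comb l creation) o\<^sub>L \<Psi> (creation i) = moebius_numer l creation i"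
  shows "extends_ball_map \<Psi> (moebius l)"
  unfolding extends_ball_map_def
proof (intro ballI)
  fix \<mu> :: "complex ^ 'n" and a :: "'n list ell2 \<Rightarrow>\<^sub>L 'n list ell2"
  assume "\<mu> \<in> ball 0 1" and a: "a \<in> nc_disc_algebra"
  then have \<mu>: "norm \<mu> < 1" by simp
  let ?A = "nc_disc_algebra :: ('n list ell2 \<Rightarrow>\<^sub>L 'n list ell2) set"
  let ?\<phi> = "point_character \<mu>"
  note \<phi> = characterD[OF point_character_spec(1)[OF \<mu>]]
    and \<phi>_diff = character_diff[OF unital_nc point_character_spec(1)[OF \<mu>]]
    and \<phi>_comb = character_row_comb[OF unital_nc point_character_spec(1)[OF \<mu>]]
  note in_nc = unital_diff[OF unital_nc] unital_id[OF unital_nc] unital_scale[OF unital_nc]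
    row_comb_in[OF unital_nc] creation_in_nc contractive_homD(2)[OF \<Psi>]
  have "inj_on \<Psi> ?A" by (metis inj_onI inv)
  then have inv_\<Psi>: "inv_into ?A \<Psi> b = \<Psi> b" if "b \<in> ?A" for b
    by (rule inv_into_f_eq) (use that inv contractive_homD(2)[OF \<Psi>] in auto)
  define \<psi> where "\<psi> = restrict (\<lambda>b. ?\<phi> (\<Psi> b)) ?A"
  have "\<psi> \<in> characters ?A"
    unfolding characters_def
    by (auto simp: \<psi>_def unital_op_algebraD[OF unital_nc] contractive_homD[OF \<Psi>] \<phi>)
  moreover have "\<psi> (creation i) = moebius l \<mu> $ i" for i
  proof -
    have \<mu>_eq: "(\<chi> j. ?\<phi> (creation j)) = \<mu>" by (simp add: vec_eq_iff point_character_spec(2)[OF \<mu>])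
    have "(1 - cdot \<mu> l) * ?\<phi> (\<Psi> (creation i)) = ?\<phi> (moebius_numer l creation i)"
      unfolding eq[symmetric] by (simp add: \<phi> \<phi>_diff \<phi>_comb \<mu>_eq in_nc)
    also have "\<dots> = l $ i * (1 - cdot \<mu> l / (1 + defect l)) - defect l * \<mu> $ i"
      unfolding moebius_numer_def
      by (simp add: \<phi> \<phi>_diff \<phi>_comb \<mu>_eq in_nc point_character_spec(2)[OF \<mu>])
    finally show ?thesis
      using one_minus_cdot_nonzero[OF l \<mu>]
      by (simp add: \<psi>_def moebius_def creation_in_nc eq_divide_eq mult.commute)
  qed
  ultimately have "\<psi> = point_character (moebius l \<mu>)"
    by (rule point_character_unique[OF norm_moebius[OF l \<mu>]])
  then show "?\<phi> (inv_into ?A \<Psi> a) = point_character (moebius l \<mu>) a"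
    using a by (metis inv_\<Psi> \<psi>_def restrict_apply')
qed

text \<open>
  Invariance of \<open>l\<close> means that the shift fixes \<open>A\<close>, hence permutes the numerators \<open>N\<^sub>i\<close> as it permutes the
  \<open>L\<^sub>i\<close>. Cancelling the invertible factor \<open>1 - A\<close> gives the commutation on generators.
\<close>

lemma moebius_hom_commutes_shift:
  fixes l :: "complex ^ 'n::finite"
  assumes l: "norm l < 1" and \<tau>: "\<tau> permutes UNIV" and inv: "coord_shift \<tau> l = l"
    and \<Psi>: "contractive_hom nc_disc_algebra \<Psi>"
    and eq: "\<And>i. (id_blinfun - row_comb l creation) o\<^sub>L \<Psi> (creation i) = moebius_numer l creation i"
    and T: "contractive_hom nc_disc_algebra T" "\<And>i. T (creation i) = creation (\<tau> i)"
    and a: "a \<in> nc_disc_algebra"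
  shows "T (\<Psi> a) = \<Psi> (T a)"
proof (rule nc_hom_eqI[OF contractive_hom_comp[OF T(1) \<Psi>] contractive_hom_comp[OF \<Psi> T(1)] _ a])
  fix b :: "'n list ell2 \<Rightarrow>\<^sub>L 'n list ell2" assume "b \<in> range creation"
  then obtain i where b: "b = creation i" by blast
  note in_nc = unital_diff[OF unital_nc] unital_id[OF unital_nc]
    row_comb_in[OF unital_nc] creation_in_nc contractive_homD(2)[OF \<Psi>]
  have l_\<tau>: "l $ \<tau> j = l $ j" for j using inv by (metis coord_shift_def vec_lambda_beta)
  have comb: "row_comb l (\<lambda>j. creation (\<tau> j)) = row_comb l creation"
  proof -
    have "row_comb l (\<lambda>j. creation (\<tau> j)) = (\<Sum>j\<in>UNIV. cnj (l $ \<tau> j) *\<^sub>o creation (\<tau> j))"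
      by (simp add: row_comb_def l_\<tau>)
    also have "\<dots> = row_comb l creation"
      unfolding row_comb_def by (rule sum.permute[OF \<tau>, unfolded o_def, symmetric])
    finally show ?thesis .
  qed
  obtain r :: "'n list ell2 \<Rightarrow>\<^sub>L 'n list ell2" where r: "r \<in> nc_disc_algebra"
    "r o\<^sub>L (id_blinfun - row_comb l creation) = id_blinfun"
    "(id_blinfun - row_comb l creation) o\<^sub>L r = id_blinfun"
    by (rule row_comb_resolvent[OF unital_nc closed_nc row_isometry_creation creation_in_nc l])
  have "(id_blinfun - row_comb l creation) o\<^sub>L T (\<Psi> (creation i))
      = T ((id_blinfun - row_comb l creation) o\<^sub>L \<Psi> (creation i))"
    by (simp add: contractive_homD(1,5)[OF T(1)] contractive_hom_diff[OF unital_nc T(1)]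
        contractive_hom_row_comb[OF unital_nc T(1)] in_nc T(2) comb)
  also have "\<dots> = moebius_numer l (\<lambda>j. creation (\<tau> j)) i"
    by (simp add: eq contractive_hom_moebius_numer[OF unital_nc T(1)] creation_in_nc T(2))
  also have "\<dots> = moebius_numer l creation (\<tau> i)"
    by (simp add: moebius_numer_def comb l_\<tau>)
  also have "\<dots> = (id_blinfun - row_comb l creation) o\<^sub>L \<Psi> (creation (\<tau> i))"
    by (simp add: eq)
  finally have "r o\<^sub>L ((id_blinfun - row_comb l creation) o\<^sub>L T (\<Psi> (creation i))) =
      r o\<^sub>L ((id_blinfun - row_comb l creation) o\<^sub>L \<Psi> (creation (\<tau> i)))" by simp
  then show "T (\<Psi> b) = \<Psi> (T b)"
    by (simp add: b T(2) blinfun_comp_assoc[symmetric] r(2))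
qed

theorem proposition8p2:
  fixes \<tau> :: "'n::finite \<Rightarrow> 'n" and \<alpha> :: "complex ^ 'n"
  assumes "\<tau> permutes UNIV"
    and "\<alpha> \<in> core_base \<tau>"
  shows "\<exists>\<theta> :: complex ^ 'n \<Rightarrow> complex ^ 'n.
      (ball_automorphism \<theta> \<and>
       \<theta> ` core_base \<tau> = core_base \<tau> \<and>
       \<theta> 0 = \<alpha> \<and>
       (\<forall>z\<in>ball 0 1. \<theta> z = inv (coord_shift \<tau>) (\<theta> (coord_shift \<tau> z)))) \<and>
      (\<exists>\<Theta>. isometric_automorphism nc_disc_algebra \<Theta> \<and>
        extends_ball_map \<Theta> \<theta> \<and>
        (\<forall>a\<in>nc_disc_algebra. \<Theta> a =
          inv_into nc_disc_algebra (shift_automorphism \<tau>) (\<Theta> (shift_automorphism \<tau> a))))"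
proof -
  note \<tau> = assms(1)
  have \<alpha>: "norm \<alpha> < 1" "coord_shift \<tau> \<alpha> = \<alpha>" using assms(2) by (auto simp: core_base_def)
  let ?\<theta> = "moebius \<alpha>"
  let ?A = "nc_disc_algebra :: ('n list ell2 \<Rightarrow>\<^sub>L 'n list ell2) set"
  let ?T = "shift_automorphism \<tau>"
  have "ball_automorphism ?\<theta>"
    by (rule ball_automorphism_of_involution)
       (auto simp: norm_moebius moebius_involution holomorphic_moebius \<alpha>(1))
  moreover have "?\<theta> ` core_base \<tau> = core_base \<tau>"
  proof -
    have sub: "?\<theta> z \<in> core_base \<tau>" if "z \<in> core_base \<tau>" for z
      using that moebius_coord_shift[OF \<tau> \<alpha>(2), of z] norm_moebius[OF \<alpha>(1)] by (auto simp: core_base_def)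
    have "z \<in> ?\<theta> ` core_base \<tau>" if "z \<in> core_base \<tau>" for z
    proof (rule image_eqI)
      show "z = ?\<theta> (?\<theta> z)" using that moebius_involution[OF \<alpha>(1)] by (simp add: core_base_def)
    qed (rule sub[OF that])
    with sub show ?thesis by blast
  qed
  moreover have "?\<theta> 0 = \<alpha>" by (rule moebius_zero)
  moreover have "?\<theta> z = inv (coord_shift \<tau>) (?\<theta> (coord_shift \<tau> z))" for z
  proof -
    have "inj (coord_shift \<tau> :: complex ^ 'n \<Rightarrow> _)"
    proof (rule injI)
      fix x y :: "complex ^ 'n" assume "coord_shift \<tau> x = coord_shift \<tau> y"
      then have "x $ \<tau> i = y $ \<tau> i" for i by (metis coord_shift_def vec_lambda_beta)
      then show "x = y" by (metis permutes_inverses(1)[OF \<tau>] vec_eq_iff)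
    qed
    then show ?thesis by (simp add: moebius_coord_shift[OF \<tau> \<alpha>(2)])
  qed
  moreover obtain \<Theta> where \<Theta>: "contractive_hom ?A \<Theta>"
    "\<And>i. (id_blinfun - row_comb \<alpha> creation) o\<^sub>L \<Theta> (creation i) = moebius_numer \<alpha> creation i"
    "\<And>a. a \<in> ?A \<Longrightarrow> \<Theta> (\<Theta> a) = a"
    by (rule moebius_hom[OF \<alpha>(1)]) (rule that)
  have "isometric_automorphism ?A \<Theta>"
    by (rule isometric_automorphismI[OF \<Theta>(1) \<Theta>(1) \<Theta>(3) \<Theta>(3)])
  moreover have "extends_ball_map \<Theta> ?\<theta>"
    by (rule extends_ball_map_moebius[OF \<alpha>(1) \<Theta>(1,3,2)])
  moreover have "\<Theta> a = inv_into ?A ?T (\<Theta> (?T a))" if a: "a \<in> ?A" for a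
  proof -
    note T = shift_automorphism_spec[OF \<tau>]
    have "\<Theta> (?T a) = ?T (\<Theta> a)"
      using moebius_hom_commutes_shift[OF \<alpha>(1) \<tau> \<alpha>(2) \<Theta>(1,2)
          isometric_automorphism_contractive_hom[OF unital_nc T(1)] T(2) a] by simp
    moreover have "inj_on ?T ?A" using T(1) by (auto simp: isometric_automorphism_def bij_betw_def)
    ultimately show ?thesis by (simp add: contractive_homD(2)[OF \<Theta>(1) a])
  qed
  ultimately show ?thesis by blast
qed

end
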